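(* Let $G$ be a finite graph (loops and multiple edges allowed) and let $C$ be a circuit in $G$. If $G/C$ admits a nowhere-zero $4$-flow, then $G$ admits a $4$-flow $f$ such that $E(G) - E(C) \subseteq \mathrm{supp}(f)$ and $$\bigl|\{e \in E(C) : f(e) = 0\}\bigr| < \frac{1}{4}|E(C)|.$$
   Context: Graphs are finite and may have loops and multiple edges. A circuit is a connected $2$-regular graph. Contracting an edge means deleting the edge and then identifying its ends; $G/C$ is the graph obtained from $G$ by contracting all edges of $C$ (so edges of $G$ not in $C$ with both ends on $C$ become loops). For an abelian group $\Gamma$, a $\Gamma$-flow in $G$ is a pair $(D,f)$ where $D$ is an orientation of $E(G)$ and $f: E(G)\to\Gamma$ is such that, at every vertex $v$, the sum of $f$ over edges with tail $v$ equals the sum of $f$ over edges with head $v$. For a positive integer $k$, a $k$-flow is a $\mathbb{Z}$-flow with $|f(e)| < k$ for every edge $e$. The support is $\mathrm{supp}(f) = \{e \in E(G): f(e)\neq 0\}$, and a flow is nowhere-zero if its support is the whole edge set. *)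

theory Defs
  imports Complex_Main "HOL-Library.Uprod" "Graph_Theory.Digraph"
begin

text \<open>
  Undirected multigraphs. The ends of an edge form an unordered pair; a loop at \<open>v\<close>
  has the ends \<open>Upair v v\<close>, and distinct edges may have the same ends.
\<close>

record ('v, 'e) multigraph =
  mverts :: "'v set"
  medges :: "'e set"
  mends :: "'e \<Rightarrow> 'v uprod"

locale fin_multigraph =
  fixes G :: "('v, 'e) multigraph"
  assumes finite_mverts: "finite (mverts G)"
    and finite_medges: "finite (medges G)"
    and ends_in_mverts: "e \<in> medges G \<Longrightarrow> set_uprod (mends G e) \<subseteq> mverts G"

definition subgraph_of :: "('v, 'e) multigraph \<Rightarrow> ('v, 'e) multigraph \<Rightarrow> bool" where
  "subgraph_of H G \<longleftrightarrow> fin_multigraph H \<and> fin_multigraph G \<and>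
     mverts H \<subseteq> mverts G \<and> medges H \<subseteq> medges G \<and>
     (\<forall>e \<in> medges H. mends H e = mends G e)"

text \<open>A loop contributes 2 to the degree of its end.\<close>

definition mdegree :: "('v, 'e) multigraph \<Rightarrow> 'v \<Rightarrow> nat" where
  "mdegree G v = card {e \<in> medges G. v \<in> set_uprod (mends G e)}
                 + card {e \<in> medges G. mends G e = Upair v v}"

definition adjacency :: "('v, 'e) multigraph \<Rightarrow> ('v \<times> 'v) set" where
  "adjacency G = {(u, v). \<exists>e \<in> medges G. mends G e = Upair u v}"

text \<open>The graph without vertices is not connected.\<close>

definition mconnected :: "('v, 'e) multigraph \<Rightarrow> bool" where
  "mconnected G \<longleftrightarrow> mverts G \<noteq> {} \<and>
     (\<forall>u \<in> mverts G. \<forall>v \<in> mverts G. (u, v) \<in> (adjacency G)\<^sup>*)"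

text \<open>In particular a vertex with a loop and a pair of parallel edges are circuits.\<close>

definition circuit :: "('v, 'e) multigraph \<Rightarrow> bool" where
  "circuit C \<longleftrightarrow> fin_multigraph C \<and> mconnected C \<and> (\<forall>v \<in> mverts C. mdegree C v = 2)"

text \<open>
  Contraction of all edges of a set \<open>F\<close>. Deleting the edges of \<open>F\<close> and identifying the
  ends of each of them identifies exactly those vertices that lie in a common component of
  the spanning subgraph with edge set \<open>F\<close>; the vertices of the contracted graph are these
  classes of vertices. Edges outside \<open>F\<close> are kept under their names.
\<close>

definition joined_by :: "('v, 'e) multigraph \<Rightarrow> 'e set \<Rightarrow> ('v \<times> 'v) set" where
  "joined_by G F = {(u, v). u \<in> mverts G \<and> v \<in> mverts G \<and>
     (u, v) \<in> (adjacency (G\<lparr>medges := medges G \<inter> F\<rparr>))\<^sup>*}"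

definition contract :: "('v, 'e) multigraph \<Rightarrow> 'e set \<Rightarrow> ('v set, 'e) multigraph" where
  "contract G F =
     \<lparr>mverts = mverts G // joined_by G F,
      medges = medges G - F,
      mends = (\<lambda>e. map_uprod (\<lambda>v. joined_by G F `` {v}) (mends G e))\<rparr>"

definition orientation_of :: "('v, 'e) pre_digraph \<Rightarrow> ('v, 'e) multigraph \<Rightarrow> bool" where
  "orientation_of D G \<longleftrightarrow> verts D = mverts G \<and> arcs D = medges G \<and>
     (\<forall>e \<in> medges G. mends G e = Upair (tail D e) (head D e))"

text \<open>
  Flows are total functions on the type of edges; only their values on the edges of the
  graph are relevant.
\<close>

definition is_flow ::
  "('v, 'e) multigraph \<Rightarrow> ('v, 'e) pre_digraph \<Rightarrow> ('e \<Rightarrow> 'g::ab_group_add) \<Rightarrow> bool" where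
  "is_flow G D f \<longleftrightarrow> orientation_of D G \<and>
     (\<forall>v \<in> mverts G. (\<Sum>e \<in> out_arcs D v. f e) = (\<Sum>e \<in> in_arcs D v. f e))"

definition is_k_flow ::
  "nat \<Rightarrow> ('v, 'e) multigraph \<Rightarrow> ('v, 'e) pre_digraph \<Rightarrow> ('e \<Rightarrow> int) \<Rightarrow> bool" where
  "is_k_flow k G D f \<longleftrightarrow> is_flow G D f \<and> (\<forall>e \<in> medges G. \<bar>f e\<bar> < int k)"

definition flow_support :: "('v, 'e) multigraph \<Rightarrow> ('e \<Rightarrow> 'g::zero) \<Rightarrow> 'e set" where
  "flow_support G f = {e \<in> medges G. f e \<noteq> 0}"

definition nowhere_zero :: "('v, 'e) multigraph \<Rightarrow> ('e \<Rightarrow> 'g::zero) \<Rightarrow> bool" where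
  "nowhere_zero G f \<longleftrightarrow> flow_support G f = medges G"

lemma equiv_joined_by: "equiv (mverts G) (joined_by G F)"
proof (rule equivI)
  have "sym (adjacency (G\<lparr>medges := medges G \<inter> F\<rparr>))"
    unfolding sym_def adjacency_def by (auto intro!: bexI)
  then have "sym ((adjacency (G\<lparr>medges := medges G \<inter> F\<rparr>))\<^sup>*)"
    by (rule sym_rtrancl)
  then show "sym (joined_by G F)"
    by (auto simp: sym_def joined_by_def)
qed (auto simp: refl_on_def joined_by_def trans_def)

lemma fin_multigraph_contract:
  assumes "fin_multigraph G"
  shows "fin_multigraph (contract G F)"
proof -
  interpret fin_multigraph G by fact
  have "finite (mverts G // joined_by G F)"
    by (rule finite_quotient) (use finite_mverts in \<open>auto simp: joined_by_def\<close>)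
  moreover have "joined_by G F `` {v} \<in> mverts G // joined_by G F"
    if "e \<in> medges G" "v \<in> set_uprod (mends G e)" for e v
    using that ends_in_mverts by (auto intro: quotientI)
  ultimately show ?thesis
    using finite_medges by unfold_locales (auto simp: contract_def uprod.set_map)
qed

lemma circuit_contracts_to_vertex:
  assumes "subgraph_of C G" "circuit C" "u \<in> mverts C" "v \<in> mverts C"
  shows "joined_by G (medges C) `` {u} = joined_by G (medges C) `` {v}"
proof -
  have "adjacency C \<subseteq> adjacency (G\<lparr>medges := medges G \<inter> medges C\<rparr>)"
    using assms(1) by (fastforce simp: subgraph_of_def adjacency_def)
  then have "(u, v) \<in> joined_by G (medges C)"
    using assms rtrancl_mono unfolding subgraph_of_def circuit_def mconnected_def joined_by_def
    by blast
  then show ?thesis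
    by (rule equiv_class_eq[OF equiv_joined_by])
qed

end

(*
Identify 4-flows with flows in Z_2 x Z_2. A nowhere-zero flow of G/C extends to G, and adding a
constant along C shows that, unless the claim holds, each of the four group elements occurs on
exactly a quarter of the edges of C, for every such flow. To refute this, read the values around C as
a word. For c ~= 0, let u and w be vertices of C that are joined off C by edges with values outside
{0, c}. Adding c along such a path and along the arc of C from u to w gives another flow, so its word
is balanced too. Hence s and s + c occur equally often on the arc. Handshake identities for a second
letter, before and after the change, show first that all four letters occur equally often on the
arc, and then inductively that this number and |E(C)|/4 are divisible by every power of 2.
*)

theory Submission
  imports Defs "HOL-Library.Z2" "HOL-Library.Product_Plus"
begin

text \<open>A change for \<open>c\<close> can rearrange the components of edges with values outside
  {0, a} beyond control. So the test functions are computed from prefix counts of the word alone: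
  the equalities already proved force them to be constant along whatever links exist, before and
  after the change. A single handshake only sees the whole circuit; the difference of two localises
  to an arc. If the test functions agree off the arc, everything there cancels, while on the arc
  \<open>form a\<close> changes by \<open>form a c = 1\<close>, and this excess telescopes to the
  ends. Each level of divisibility supplies the test function for the next one: when
  \<open>g\<close> divides all arc counts, parities of counts divided by \<open>g\<close> become
  constant along links.\<close>

declare add_bit_eq_xor [simp del] mult_bit_eq_and [simp del]

text \<open>The symplectic form: for \<open>c \<noteq> 0\<close>, the kernel of \<open>form c\<close> is \<open>{0, c}\<close>.\<close>

definition form :: "bit \<times> bit \<Rightarrow> bit \<times> bit \<Rightarrow> bit" where
  "form c s = fst c * snd s + snd c * fst s"

lemma bit_pair_add_self [simp]: "(s :: bit \<times> bit) + s = 0" "s + (s + r) = r"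
  by (simp_all add: prod_eq_iff)

lemma form_add: "form c (r + s) = form c r + form c s"
  by (simp add: form_def algebra_simps)

lemma form_zero [simp]: "form c 0 = 0"
  by (simp add: form_def)

lemma form_self [simp]: "form c c = 0"
  by (simp add: form_def mult.commute)

lemma ex_form_eq_1:
  assumes "c \<noteq> 0"
  shows "\<exists>a. form a c = 1"
proof -
  obtain c1 c2 where c: "c = (c1, c2)" by fastforce
  show ?thesis
  proof (cases "c1 = 0")
    case True
    then have "form (1, 0) c = 1"
      using assms c by (auto simp: form_def zero_prod_def)
    then show ?thesis ..
  next
    case False
    then have "form (0, 1) c = 1"
      using c by (auto simp: form_def)
    then show ?thesis ..
  qed
qed

text \<open>\<open>form a c\<close> is the determinant of \<open>a\<close> and \<open>c\<close> mod
  2, so the hypothesis makes them a basis of the plane over Z_2.\<close>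

lemma letters_of_form:
  assumes "form a c = 1"
  shows "s = 0 \<or> s = c \<or> s = a \<or> s = a + c"
    and "a \<noteq> 0" "c \<noteq> 0" "a \<noteq> c" "a + c \<noteq> 0" "a + c \<noteq> a" "a + c \<noteq> c"
proof -
  obtain a1 a2 c1 c2 s1 s2 where *: "a = (a1, a2)" "c = (c1, c2)" "s = (s1, s2)" by fastforce
  show "s = 0 \<or> s = c \<or> s = a \<or> s = a + c"
    using assms * by (cases a1; cases a2; cases c1; cases c2; cases s1; cases s2) (auto simp: form_def zero_prod_def)
  show "a \<noteq> 0" "c \<noteq> 0" "a \<noteq> c" "a + c \<noteq> 0" "a + c \<noteq> a" "a + c \<noteq> c"
    using assms * by (cases a1; cases a2; cases c1; cases c2; auto simp: form_def zero_prod_def)+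
qed

lemma bit_add_eq_0_iff: "(a :: bit) + b = 0 \<longleftrightarrow> a = b"
  by (cases a; cases b) auto

lemma of_int_bit_eq_0_iff: "(of_int k :: bit) = 0 \<longleftrightarrow> even k"
proof
  assume "(of_int k :: bit) = 0"
  moreover have "odd k \<Longrightarrow> (of_int k :: bit) = 1"
    by (auto elim!: oddE)
  ultimately show "even k" by force
qed (auto elim!: evenE)

lemma sum_bit_telescope:
  fixes \<phi> :: "nat \<Rightarrow> bit"
  assumes "u \<le> w"
  shows "(\<Sum>i\<in>{u..<w}. \<phi> i + \<phi> (Suc i)) = \<phi> u + \<phi> w"
  using assms
proof (induction w rule: dec_induct)
  case (step n)
  then show ?case by (simp add: algebra_simps)
qed simp

section \<open>Balanced words\<close>

text \<open>
  A state stands for a flow, and \<open>word x i\<close> for its value on the \<open>i\<close>-th edge of the circuit;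
  \<open>link x c u w\<close> says that the \<open>u\<close>-th and the \<open>w\<close>-th vertex are joined off the circuit by edges
  with values outside \<open>{0, c}\<close>. The locale is inconsistent; a circuit on which no flow has
  few zeros would be an instance.
\<close>

locale kempe_words =
  fixes m :: nat
    and X :: "'s set"
    and word :: "'s \<Rightarrow> nat \<Rightarrow> bit \<times> bit"
    and link :: "'s \<Rightarrow> bit \<times> bit \<Rightarrow> nat \<Rightarrow> nat \<Rightarrow> bool"
  assumes X_nonempty: "X \<noteq> {}"
    and m_pos: "m > 0"
    and balanced: "x \<in> X \<Longrightarrow> 4 * card {i. i < m \<and> word x i = s} = m"
    and swap: "\<lbrakk>x \<in> X; c \<noteq> 0; link x c u w; u \<le> w; w < m\<rbrakk> \<Longrightarrow>
      \<exists>y\<in>X. \<forall>i<m. word y i = word x i + (if u \<le> i \<and> i < w then c else 0)"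
    and handshake: "\<lbrakk>x \<in> X; c \<noteq> 0; \<phi> m = \<phi> 0;
        \<And>u w. \<lbrakk>link x c u w; u \<le> w; w < m\<rbrakk> \<Longrightarrow> \<phi> u = \<phi> w\<rbrakk> \<Longrightarrow>
      (\<Sum>i<m. form c (word x i) * (\<phi> i + \<phi> (Suc i))) = (0 :: bit)"
begin

definition cnt :: "'s \<Rightarrow> bit \<times> bit \<Rightarrow> nat \<Rightarrow> int" where
  "cnt x s i = int (card {j. j < i \<and> word x j = s})"

lemma cnt_0 [simp]: "cnt x s 0 = 0"
  by (simp add: cnt_def)

lemma cnt_Suc: "cnt x s (Suc i) = cnt x s i + of_bool (word x i = s)"
proof -
  have "{j. j < Suc i \<and> word x j = s} =
      (if word x i = s then insert i {j. j < i \<and> word x j = s} else {j. j < i \<and> word x j = s})"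
    by (auto simp: less_Suc_eq)
  then show ?thesis by (simp add: cnt_def)
qed

lemma cnt_total: "x \<in> X \<Longrightarrow> 4 * cnt x s m = int m"
  unfolding cnt_def using balanced[of x s] by linarith

definition swapped :: "'s \<Rightarrow> bit \<times> bit \<Rightarrow> nat \<Rightarrow> nat \<Rightarrow> 's \<Rightarrow> bool" where
  "swapped x c u w y \<longleftrightarrow> y \<in> X \<and>
     (\<forall>i<m. word y i = word x i + (if u \<le> i \<and> i < w then c else 0))"

text \<open>Translation by \<open>c\<close> is an involution, so a letter \<open>s\<close> of
  \<open>y\<close> on the arc stands where \<open>x\<close> has \<open>s + c\<close>. The three
  parts treat positions before, on and after the arc; the last keeps the accumulated exchange as an
  offset.\<close>

lemma cnt_swapped:
  assumes "swapped x c u w y" "u \<le> w" "w < m"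
  shows "i \<le> u \<Longrightarrow> cnt y s i = cnt x s i"
    and "u \<le> i \<Longrightarrow> i \<le> w \<Longrightarrow> cnt y s i = cnt x s u + (cnt x (s + c) i - cnt x (s + c) u)"
    and "w \<le> i \<Longrightarrow> i \<le> m \<Longrightarrow> cnt y s i = cnt x s i - (cnt x s w - cnt x s u) + (cnt x (s + c) w - cnt x (s + c) u)"
proof -
  have sw: "word y i = word x i + (if u \<le> i \<and> i < w then c else 0)" if "i < m" for i
    using assms that by (simp add: swapped_def)
  show *: "cnt y s i = cnt x s i" if "i \<le> u" for i
    using that
  proof (induction i)
    case (Suc i)
    then show ?case using sw[of i] assms by (simp add: cnt_Suc)
  qed simp
  have eq: "r + c = s \<longleftrightarrow> r = s + c" for r
    by (metis add.assoc add.commute bit_pair_add_self(2))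
  show **: "cnt y s i = cnt x s u + (cnt x (s + c) i - cnt x (s + c) u)" if "u \<le> i" "i \<le> w" for i
    using that
  proof (induction i rule: dec_induct)
    case base
    then show ?case using *[of u] by simp
  next
    case (step i)
    then show ?case using sw[of i] assms eq[of "word x i"] by (simp add: cnt_Suc)
  qed
  show "cnt y s i = cnt x s i - (cnt x s w - cnt x s u) + (cnt x (s + c) w - cnt x (s + c) u)"
    if "w \<le> i" "i \<le> m" for i
    using that
  proof (induction i rule: dec_induct)
    case base
    then show ?case using **[of w] assms by simp
  next
    case (step i)
    then show ?case using sw[of i] assms by (simp add: cnt_Suc)
  qed
qed

lemma link_pair_balanced:
  assumes "x \<in> X" "c \<noteq> 0" "link x c u w" "u \<le> w" "w < m"
  shows "cnt x (s + c) w - cnt x (s + c) u = cnt x s w - cnt x s u"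
proof -
  obtain y where y: "swapped x c u w y"
    using swap[OF assms] by (auto simp: swapped_def)
  then have "cnt y s m = cnt x s m"
    using cnt_total[of x s] cnt_total[of y s] assms by (simp add: swapped_def)
  then show ?thesis
    using cnt_swapped(3)[OF y assms(4,5), of m s] assms by simp
qed

text \<open>Adding the two handshakes leaves only the arc, because words and test functions agree
  elsewhere. On the arc \<open>form a\<close> grows by 1, which contributes the extra terms
  \<open>\<psi> i + \<psi> (Suc i)\<close>; they telescope to the ends, where \<open>\<psi>\<close>
  equals \<open>\<phi>\<close>.\<close>

lemma handshake_difference:
  assumes x: "x \<in> X" and y: "swapped x c u w y" and uw: "u \<le> w" "w < m"
    and a: "form a c = 1"
    and \<phi>: "\<phi> m = \<phi> 0" "\<And>i j. \<lbrakk>link x a i j; i \<le> j; j < m\<rbrakk> \<Longrightarrow> \<phi> i = \<phi> j"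
    and \<psi>: "\<psi> m = \<psi> 0" "\<And>i j. \<lbrakk>link y a i j; i \<le> j; j < m\<rbrakk> \<Longrightarrow> \<psi> i = \<psi> j"
    and out: "\<And>i. i \<le> u \<Longrightarrow> \<psi> i = \<phi> i" "\<And>i. w \<le> i \<Longrightarrow> i \<le> m \<Longrightarrow> \<psi> i = \<phi> i"
  shows "(\<Sum>i\<in>{u..<w}. form a (word x i) * ((\<phi> i + \<psi> i) + (\<phi> (Suc i) + \<psi> (Suc i)))) = \<phi> u + \<phi> w"
proof -
  have a0: "a \<noteq> 0" using letters_of_form[OF a] by simp
  have yX: "y \<in> X" using y by (simp add: swapped_def)
  have split: "{..<m} = {..<u} \<union> ({u..<w} \<union> {w..<m})" using uw by auto
  have "0 = (\<Sum>i<m. form a (word x i) * (\<phi> i + \<phi> (Suc i))) + (\<Sum>i<m. form a (word y i) * (\<psi> i + \<psi> (Suc i)))"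
    using handshake[of x a \<phi>, OF x a0 \<phi>] handshake[of y a \<psi>, OF yX a0 \<psi>] by simp
  also have "\<dots> = (\<Sum>i<m. form a (word x i) * (\<phi> i + \<phi> (Suc i)) + form a (word y i) * (\<psi> i + \<psi> (Suc i)))"
    by (rule sum.distrib[symmetric])
  also have "\<dots> = (\<Sum>i\<in>{u..<w}. form a (word x i) * (\<phi> i + \<phi> (Suc i)) + form a (word y i) * (\<psi> i + \<psi> (Suc i)))"
  proof (rule sum.mono_neutral_right)
    show "\<forall>i\<in>{..<m} - {u..<w}. form a (word x i) * (\<phi> i + \<phi> (Suc i)) + form a (word y i) * (\<psi> i + \<psi> (Suc i)) = 0"
    proof
      fix i assume i: "i \<in> {..<m} - {u..<w}"
      then have "\<psi> i = \<phi> i" "\<psi> (Suc i) = \<phi> (Suc i)" using out[of i] out[of "Suc i"] by auto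
      moreover have "word y i = word x i" using i y by (auto simp: swapped_def)
      ultimately show "form a (word x i) * (\<phi> i + \<phi> (Suc i)) + form a (word y i) * (\<psi> i + \<psi> (Suc i)) = 0" by simp
    qed
  qed (use uw in auto)
  also have "\<dots> = (\<Sum>i\<in>{u..<w}. form a (word x i) * ((\<phi> i + \<psi> i) + (\<phi> (Suc i) + \<psi> (Suc i))) + (\<psi> i + \<psi> (Suc i)))"
  proof (rule sum.cong)
    fix i assume "i \<in> {u..<w}"
    then have *: "form a (word y i) = form a (word x i) + 1"
      using y uw a by (simp add: swapped_def form_add)
    show "form a (word x i) * (\<phi> i + \<phi> (Suc i)) + form a (word y i) * (\<psi> i + \<psi> (Suc i)) =
        form a (word x i) * ((\<phi> i + \<psi> i) + (\<phi> (Suc i) + \<psi> (Suc i))) + (\<psi> i + \<psi> (Suc i))"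
      by (simp add: * distrib_left distrib_right add_ac)
  qed simp
  also have "\<dots> = (\<Sum>i\<in>{u..<w}. form a (word x i) * ((\<phi> i + \<psi> i) + (\<phi> (Suc i) + \<psi> (Suc i)))) + (\<psi> u + \<psi> w)"
    using sum_bit_telescope[OF uw(1), of \<psi>] by (simp add: sum.distrib)
  finally have "(\<Sum>i\<in>{u..<w}. form a (word x i) * ((\<phi> i + \<psi> i) + (\<phi> (Suc i) + \<psi> (Suc i)))) = \<psi> u + \<psi> w"
    by (metis bit_add_eq_0_iff)
  then show ?thesis
    using out(1)[of u] out(2)[of w] uw by simp
qed

text \<open>Pair equality for \<open>c\<close> leaves one unknown: whether \<open>0\<close> and
  \<open>a\<close> are equally frequent on the arc. The handshakes transport a truth value:
  \<open>F x\<close> holds at \<open>u\<close> by construction, and the vanishing sum transfers it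
  to \<open>w\<close>.\<close>

lemma link_balanced:
  assumes x: "x \<in> X" and c: "c \<noteq> 0" and link: "link x c u w" "u \<le> w" "w < m"
  shows "cnt x s w - cnt x s u = cnt x 0 w - cnt x 0 u"
proof -
  obtain a where a: "form a c = 1" using ex_form_eq_1[OF c] ..
  have a0: "a \<noteq> 0" using letters_of_form[OF a] by simp
  obtain y where y: "swapped x c u w y"
    using swap[OF x c link] by (auto simp: swapped_def)
  then have yX: "y \<in> X" by (simp add: swapped_def)
  \<comment> \<open>\<open>F y\<close> and \<open>F x\<close> agree because swapping exchanges the two equations on the arc; then only the
    end points of the arc contribute to the difference of the handshake identities.\<close>
  define F where "F z i \<longleftrightarrow> cnt z 0 i - cnt z a i = cnt x 0 u - cnt x a u \<and>
      cnt z c i - cnt z (a + c) i = cnt x c u - cnt x (a + c) u" for z i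
  \<comment> \<open>Pair equality on an \<open>a\<close>-link matches \<open>0\<close> with
    \<open>a\<close> and \<open>c\<close> with \<open>a + c\<close>, the two differences in
    \<open>F\<close>.\<close>
  have F_link: "F z i = F z j" if "z \<in> X" "link z a i j" "i \<le> j" "j < m" for z i j
    using link_pair_balanced[OF that(1) a0 that(2-4), of 0] link_pair_balanced[OF that(1) a0 that(2-4), of c]
    by (auto simp: F_def add.commute)
  have F_total: "F z m = F z 0" if "z \<in> X" for z
  proof -
    have "cnt z s m = cnt z 0 m" for s
      using cnt_total[OF that, of s] cnt_total[OF that, of 0] by simp
    from this[of a] this[of c] this[of "a + c"] show ?thesis by (simp add: F_def)
  qed
  note pair = link_pair_balanced[OF x c link, of 0] link_pair_balanced[OF x c link, of a]
    link_pair_balanced[OF x c link, of c] link_pair_balanced[OF x c link, of "a + c"]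
  have "F y i = F x i" if "i \<le> m" for i
  proof -
    consider "i \<le> u" | "u \<le> i" "i \<le> w" | "w \<le> i" by linarith
    then show ?thesis
    proof cases
      case 1
      then show ?thesis using cnt_swapped(1)[OF y link(2,3)] by (simp add: F_def)
    next
      case 2
      then show ?thesis using cnt_swapped(2)[OF y link(2,3)] by (auto simp: F_def add.assoc)
    next
      case 3
      then show ?thesis using cnt_swapped(3)[OF y link(2,3) _ that] pair by (simp add: F_def add.assoc)
    qed
  qed
  then have Fy: "(of_bool (F y i) :: bit) = of_bool (F x i)" if "i \<le> m" for i
    using that by simp
  have "(\<Sum>i\<in>{u..<w}. form a (word x i) * ((of_bool (F x i) + of_bool (F y i)) +
      (of_bool (F x (Suc i)) + of_bool (F y (Suc i))))) = (of_bool (F x u) + of_bool (F x w) :: bit)"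
    by (rule handshake_difference[OF x y link(2,3) a])
      (use F_link[OF x] F_link[OF yX] F_total[OF x] F_total[OF yX] Fy link in auto)
  moreover have "(\<Sum>i\<in>{u..<w}. form a (word x i) * ((of_bool (F x i) + of_bool (F y i)) +
      (of_bool (F x (Suc i)) + of_bool (F y (Suc i))))) = (0 :: bit)"
    using Fy link by (intro sum.neutral) simp
  moreover have "F x u" by (simp add: F_def)
  ultimately have "F x w" by (cases "F x w") auto
  then have "cnt x a w - cnt x a u = cnt x 0 w - cnt x 0 u" by (simp add: F_def)
  then show ?thesis
    using letters_of_form(1)[OF a, of s] pair by auto
qed

section \<open>Descent over the powers of 2\<close>

definition par :: "int \<Rightarrow> int \<Rightarrow> int \<Rightarrow> bit" where
  "par g p q = of_int (p div g + q div g)"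

text \<open>Both quotients grow by the same integer, which cancels mod 2. This is why
  \<open>par\<close> adds two quotients: either one alone may change parity along a link.\<close>

lemma par_shift:
  assumes "g dvd d" "g \<noteq> 0"
  shows "par g (p + d) (q + d) = par g p q"
proof -
  obtain k where "d = g * k" using assms by blast
  then have "par g (p + d) (q + d) = par g p q + of_int (2 * k)"
    using assms by (simp add: par_def)
  then show ?thesis by simp
qed

lemma par_commute: "par g p q = par g q p"
  by (simp add: par_def add.commute)

lemma par_same [simp]: "par g p p = 0"
  by (simp add: par_def)

text \<open>\<open>form a\<close> is 1 only at the letters \<open>c\<close> and
  \<open>a + c\<close>. At \<open>c\<close> the count of \<open>0\<close> stands still, so its two
  quotients cancel; at the other letters the count of \<open>c\<close> stands still and both sides
  vanish. What remains involves the count of \<open>c\<close> alone and telescopes.\<close>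

lemma form_par:
  assumes "form a c = 1"
  shows "form a (word x i) * (par g (cnt x 0 i - p) (cnt x c i - q) + par g (cnt x 0 (Suc i) - p) (cnt x c (Suc i) - q)) =
    of_int ((cnt x c i - q) div g) + of_int ((cnt x c (Suc i) - q) div g)"
proof -
  note l = letters_of_form[OF assms]
  have f: "form a 0 = 0" "form a c = 1" "form a a = 0" "form a (a + c) = 1"
    using assms by (simp_all add: form_add)
  consider "word x i = 0" | "word x i = c" | "word x i = a" | "word x i = a + c" using l(1) by blast
  then show ?thesis
  proof cases
    case 2
    have "(b :: bit) + p + (b + q) = p + q" for b p q
      by (cases b; cases p; cases q) auto
    with 2 show ?thesis using f l(2-) by (simp add: cnt_Suc par_def)
  qed (use f l(2-) in \<open>simp_all add: cnt_Suc par_def\<close>)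
qed

text \<open>With \<open>par g\<close> of the counts of \<open>0\<close> and \<open>c\<close> as test
  function, the handshake for \<open>a\<close> telescopes to the parity of the total divided by
  \<open>g\<close>. \<open>handshake_difference\<close> achieves the same for an arc.\<close>

lemma cnt_dvd_double:
  assumes g: "g > 0"
    and total: "\<And>x. x \<in> X \<Longrightarrow> g dvd cnt x 0 m"
    and links: "\<And>x c u w. \<lbrakk>x \<in> X; c \<noteq> 0; link x c u w; u \<le> w; w < m\<rbrakk> \<Longrightarrow> g dvd cnt x 0 w - cnt x 0 u"
  shows "x \<in> X \<Longrightarrow> 2 * g dvd cnt x 0 m"
    and "\<lbrakk>x \<in> X; c \<noteq> 0; link x c u w; u \<le> w; w < m\<rbrakk> \<Longrightarrow> 2 * g dvd cnt x 0 w - cnt x 0 u"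
proof -
  have double: "2 * g dvd k" if "g dvd k" "(of_int (k div g) :: bit) = 0" for k
    using that g by (metis dvd_div_mult_self mult_dvd_mono of_int_bit_eq_0_iff dvd_refl)
  \<comment> \<open>By \<open>link_balanced\<close> both counts advance by the same amount, which
    preserves their comparison; that \<open>g\<close> divides this amount preserves
    \<open>par g\<close>.\<close>
  have par_link: "par g (cnt z 0 j - p) (cnt z d j - q) = par g (cnt z 0 i - p) (cnt z d i - q)"
      "cnt z 0 j - p < cnt z d j - q \<longleftrightarrow> cnt z 0 i - p < cnt z d i - q"
    if z: "z \<in> X" "b \<noteq> 0" "link z b i j" "i \<le> j" "j < m" for z b d i j p q
  proof -
    have *: "cnt z 0 j - p = (cnt z 0 i - p) + (cnt z 0 j - cnt z 0 i)"
      "cnt z d j - q = (cnt z d i - q) + (cnt z 0 j - cnt z 0 i)"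
      using link_balanced[OF z, of d] by simp_all
    show "par g (cnt z 0 j - p) (cnt z d j - q) = par g (cnt z 0 i - p) (cnt z d i - q)"
      unfolding * by (rule par_shift) (use links[OF z] g in auto)
    show "cnt z 0 j - p < cnt z d j - q \<longleftrightarrow> cnt z 0 i - p < cnt z d i - q"
      using link_balanced[OF z, of d] by linarith
  qed
  have cnt_m: "cnt z s m = cnt z 0 m" if "z \<in> X" for z s
    using cnt_total[OF that, of s] cnt_total[OF that, of 0] by simp
  have par_total: "par g (cnt z 0 m - p) (cnt z d m - q) = par g (cnt z 0 0 - p) (cnt z d 0 - q)"
    if "z \<in> X" for z d p q
    using par_shift[OF total[OF that], of "- p" "- q"] g cnt_m[OF that, of d] by simp
  show "2 * g dvd cnt x 0 m" if x: "x \<in> X" for x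
  proof -
    obtain c :: "bit \<times> bit" where c: "c \<noteq> 0"
      by (metis one_neq_zero prod.sel(1) zero_prod_def)
    obtain a where a: "form a c = 1" using ex_form_eq_1[OF c] ..
    have a0: "a \<noteq> 0" using letters_of_form[OF a] by simp
    have "0 = (\<Sum>i<m. form a (word x i) * (par g (cnt x 0 i - 0) (cnt x c i - 0) +
        par g (cnt x 0 (Suc i) - 0) (cnt x c (Suc i) - 0)))"
      by (rule handshake[OF x a0, symmetric]) (use par_total[OF x, of 0 c 0] par_link(1)[OF x a0, where p = 0 and q = 0 and d = c] in auto)
    also have "\<dots> = (\<Sum>i\<in>{0..<m}. of_int (cnt x c i div g) + of_int (cnt x c (Suc i) div g))"
      unfolding form_par[OF a] by (simp add: atLeast0LessThan)
    also have "\<dots> = of_int (cnt x c m div g)"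
      using sum_bit_telescope[of 0 m "\<lambda>i. of_int (cnt x c i div g)"] by simp
    finally show ?thesis using double[OF total[OF x]] cnt_m[OF x, of c] by simp
  qed
  show "2 * g dvd cnt x 0 w - cnt x 0 u"
    if x: "x \<in> X" and c: "c \<noteq> 0" and link: "link x c u w" "u \<le> w" "w < m" for x c u w
  proof -
    obtain a where a: "form a c = 1" using ex_form_eq_1[OF c] ..
    have a0: "a \<noteq> 0" using letters_of_form[OF a] by simp
    obtain y where y: "swapped x c u w y"
      using swap[OF x c link] by (auto simp: swapped_def)
    then have yX: "y \<in> X" by (simp add: swapped_def)
    \<comment> \<open>Subtracting the counts of \<open>x\<close> at \<open>u\<close>, for
      \<open>y\<close> as well, makes the exchange of \<open>A\<close> and \<open>B\<close> on the
      arc exact.\<close>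
    define A where "A z i = cnt z 0 i - cnt x 0 u" for z i
    define B where "B z i = cnt z c i - cnt x c u" for z i
    \<comment> \<open>Swapping exchanges \<open>A\<close> and \<open>B\<close> on the arc, so that the cutoff \<open>A < B\<close> makes the two handshake
      identities add up to one for \<open>par g A B\<close>, which vanishes on the diagonal.\<close>
    define \<phi> where "\<phi> z i = (if A z i < B z i then par g (A z i) (B z i) else 0)" for z i
    have \<phi>_total: "\<phi> z m = \<phi> z 0" if "z \<in> X" for z
      using par_total[OF that, of "cnt x 0 u" c "cnt x c u"] cnt_m[OF that, of c]
      by (simp add: \<phi>_def A_def B_def)
    have \<phi>_link: "\<phi> z i = \<phi> z j" if "z \<in> X" "link z a i j" "i \<le> j" "j < m" for z i j
      using par_link[OF that(1) a0 that(2-4), of "cnt x 0 u" c "cnt x c u"]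
      by (simp add: \<phi>_def A_def B_def)
    have AB: "A y i = B x i" "B y i = A x i" if "u \<le> i" "i \<le> w" for i
      using cnt_swapped(2)[OF y link(2,3) that] by (simp_all add: A_def B_def)
    have ABw: "A x w = B x w" using link_balanced[OF x c link, of c] by (simp add: A_def B_def)
    have sum\<phi>: "\<phi> x i + \<phi> y i = par g (A x i) (B x i)" if "u \<le> i" "i \<le> w" for i
      using AB[OF that] par_commute[of g "A x i" "B x i"] by (auto simp: \<phi>_def not_less le_less)
    have out: "\<phi> y i = \<phi> x i" if "i \<le> u \<or> (w \<le> i \<and> i \<le> m)" for i
    proof -
      have "cnt y s i = cnt x s i" for s
        using that cnt_swapped(1)[OF y link(2,3), of i s] cnt_swapped(3)[OF y link(2,3), of i s]
          link_pair_balanced[OF x c link, of s] by fastforce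
      then show ?thesis by (simp add: \<phi>_def A_def B_def)
    qed
    \<comment> \<open>\<open>A x\<close> and \<open>B x\<close> meet at both ends of the arc: both
      are 0 at \<open>u\<close>, and they agree at \<open>w\<close> by \<open>link_balanced\<close>.
      The strict cutoff thus makes both end terms 0.\<close>
    have "0 = \<phi> x u + \<phi> x w" using ABw by (simp add: \<phi>_def A_def B_def)
    also have "\<dots> = (\<Sum>i\<in>{u..<w}. form a (word x i) * ((\<phi> x i + \<phi> y i) + (\<phi> x (Suc i) + \<phi> y (Suc i))))"
      by (rule handshake_difference[OF x y link(2,3) a, symmetric])
        (use \<phi>_link[OF x] \<phi>_link[OF yX] \<phi>_total[OF x] \<phi>_total[OF yX] out in auto)
    also have "\<dots> = (\<Sum>i\<in>{u..<w}. form a (word x i) * (par g (A x i) (B x i) + par g (A x (Suc i)) (B x (Suc i))))"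
      using sum\<phi> by (intro sum.cong) auto
    also have "\<dots> = (\<Sum>i\<in>{u..<w}. of_int (B x i div g) + of_int (B x (Suc i) div g))"
      unfolding A_def B_def form_par[OF a] ..
    also have "\<dots> = of_int (B x w div g)"
      using sum_bit_telescope[of u w "\<lambda>i. of_int (B x i div g)"] link by (simp add: B_def)
    finally show ?thesis using double[OF links[OF x c link]] ABw by (simp add: A_def)
  qed
qed

lemma inconsistent: False
proof -
  have *: "(\<forall>x\<in>X. 2 ^ k dvd cnt x 0 m) \<and>
      (\<forall>x\<in>X. \<forall>c u w. c \<noteq> 0 \<longrightarrow> link x c u w \<longrightarrow> u \<le> w \<longrightarrow> w < m \<longrightarrow> 2 ^ k dvd cnt x 0 w - cnt x 0 u)" for k
  proof (induction k)
    case (Suc k)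
    show ?case
      using cnt_dvd_double[of "2 ^ k"] Suc.IH by simp
  qed simp
  obtain x where x: "x \<in> X" using X_nonempty by blast
  have pos: "cnt x 0 m > 0" using cnt_total[OF x, of 0] m_pos by linarith
  have "2 ^ nat (cnt x 0 m) \<le> cnt x 0 m"
    using * x pos by (intro zdvd_imp_le) auto
  moreover have "int (nat (cnt x 0 m)) < 2 ^ nat (cnt x 0 m)"
    using less_exp[of "nat (cnt x 0 m)"] by (metis of_nat_less_iff of_nat_numeral of_nat_power)
  ultimately show False using pos by simp
qed

end
section \<open>Flows\<close>

text \<open>
  Conservation in dual form: the boundary vanishes iff it pairs to 0 with every function on the vertices.
\<close>

definition bit_flow :: "'e set \<Rightarrow> ('e \<Rightarrow> 'v) \<Rightarrow> ('e \<Rightarrow> 'v) \<Rightarrow> ('e \<Rightarrow> bit) \<Rightarrow> bool" where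
  "bit_flow E t h y \<longleftrightarrow> (\<forall>\<xi>. (\<Sum>e\<in>E. y e * (\<xi> (t e) + \<xi> (h e))) = 0)"

definition int_flow :: "'e set \<Rightarrow> ('e \<Rightarrow> 'v) \<Rightarrow> ('e \<Rightarrow> 'v) \<Rightarrow> ('e \<Rightarrow> int) \<Rightarrow> bool" where
  "int_flow E t h f \<longleftrightarrow> (\<forall>\<xi>. (\<Sum>e\<in>E. f e * (\<xi> (t e) - \<xi> (h e))) = 0)"

lemma bit_flowD: "bit_flow E t h y \<Longrightarrow> (\<Sum>e\<in>E. y e * (\<xi> (t e) + \<xi> (h e))) = 0"
  by (simp add: bit_flow_def)

lemma int_flowD: "int_flow E t h f \<Longrightarrow> (\<Sum>e\<in>E. f e * (\<xi> (t e) - \<xi> (h e))) = 0"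
  by (simp add: int_flow_def)

lemma bit_flow_add: "bit_flow E t h y \<Longrightarrow> bit_flow E t h z \<Longrightarrow> bit_flow E t h (\<lambda>e. y e + z e)"
  by (simp add: bit_flow_def distrib_right sum.distrib)

lemma bit_flow_mult: "bit_flow E t h y \<Longrightarrow> bit_flow E t h (\<lambda>e. b * y e)"
  by (simp add: bit_flow_def mult.assoc flip: sum_distrib_left)

lemma int_flow_add: "int_flow E t h f \<Longrightarrow> int_flow E t h g \<Longrightarrow> int_flow E t h (\<lambda>e. f e + g e)"
  by (simp add: int_flow_def distrib_right sum.distrib)

lemma int_flow_mult: "int_flow E t h f \<Longrightarrow> int_flow E t h (\<lambda>e. k * f e)"
  by (simp add: int_flow_def mult.assoc flip: sum_distrib_left)

section \<open>Passage between integer flows and Z_2-flows\<close>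

lemma bit_flow_of_int:
  fixes t h :: "'a \<Rightarrow> 'b"
  assumes "int_flow E t h f"
  shows "bit_flow E t h (\<lambda>e. of_int (f e))"
  unfolding bit_flow_def
proof
  fix \<xi> :: "'b \<Rightarrow> bit"
  define \<zeta> :: "'b \<Rightarrow> int" where "\<zeta> v = of_bool (\<xi> v = 1)" for v
  have *: "of_int (\<zeta> v) = \<xi> v" for v
    by (cases "\<xi> v") (auto simp: \<zeta>_def)
  have minus: "(a :: bit) - b = a + b" for a b
    by (cases a; cases b) auto
  have "(\<Sum>e\<in>E. of_int (f e) * (\<xi> (t e) + \<xi> (h e))) = of_int (\<Sum>e\<in>E. f e * (\<zeta> (t e) - \<zeta> (h e)))"
    by (simp add: * minus)
  then show "(\<Sum>e\<in>E. of_int (f e) * (\<xi> (t e) + \<xi> (h e))) = 0"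
    using int_flowD[OF assms] by simp
qed

text \<open>
  Induction on the number of edges: two edges at a common end are replaced by one edge between their
  other ends.
\<close>

lemma bit_flow_const_1_orientable:
  assumes "finite E" "bit_flow E t h (\<lambda>_. 1)"
  shows "\<exists>s :: _ \<Rightarrow> int. (\<forall>e\<in>E. s e = 1 \<or> s e = -1) \<and> int_flow E t h s"
  using assms
proof (induction "card E" arbitrary: E t)
  case 0
  then show ?case by (auto simp: int_flow_def)
next
  case (Suc n)
  then obtain a where a: "a \<in> E" by fastforce
  show ?case
  proof (cases "t a = h a")
    case True
    have "bit_flow (E - {a}) t h (\<lambda>_. 1)"
      using Suc.prems a True unfolding bit_flow_def by (simp add: sum.remove)
    then obtain s where s: "\<forall>e\<in>E - {a}. s e = 1 \<or> s e = -1" "int_flow (E - {a}) t h s"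
      using Suc.hyps(1)[of "E - {a}" t] Suc.hyps(2)[symmetric] Suc.prems a by auto
    have "int_flow E t h (s(a := 1))"
      unfolding int_flow_def
    proof
      fix \<xi> :: "_ \<Rightarrow> int"
      have "(\<Sum>e\<in>E - {a}. (s(a := 1)) e * (\<xi> (t e) - \<xi> (h e))) = (\<Sum>e\<in>E - {a}. s e * (\<xi> (t e) - \<xi> (h e)))"
        by (rule sum.cong) auto
      then show "(\<Sum>e\<in>E. (s(a := 1)) e * (\<xi> (t e) - \<xi> (h e))) = 0"
        using int_flowD[OF s(2), of \<xi>] Suc.prems(1) a True by (simp add: sum.remove)
    qed
    with s(1) show ?thesis by (intro exI[of _ "s(a := 1)"]) auto
  next
    case False
    define v where "v = t a"
    \<comment> \<open>Tested on the indicator of \<open>v\<close>, the hypothesis says that an even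
      number of non-loop edges meet \<open>v\<close>; besides \<open>a\<close> there is thus another
      one, \<open>b\<close>.\<close>
    have "(\<Sum>e\<in>E. of_bool (t e = v) + of_bool (h e = v)) = (0 :: bit)"
      using bit_flowD[OF Suc.prems(2), of "\<lambda>u. of_bool (u = v)"] by simp
    then have "(\<Sum>e\<in>E - {a}. of_bool (t e = v) + of_bool (h e = v)) = (1 :: bit)"
      using Suc.prems(1) a False by (simp add: sum.remove v_def bit_add_eq_0_iff)
    then obtain b where b: "b \<in> E - {a}" "of_bool (t b = v) + of_bool (h b = v) \<noteq> (0 :: bit)"
      by (metis (mono_tags, lifting) sum.neutral zero_neq_one)
    define u where "u = (if t b = v then h b else t b)"
    have ends: "(t b = v \<and> h b = u) \<or> (t b = u \<and> h b = v)" "h b = v \<longleftrightarrow> t b \<noteq> v"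
      using b(2) by (auto simp: u_def)
    define E' where "E' = E - {b}"
    \<comment> \<open>\<open>a\<close> now runs from \<open>u\<close> to \<open>h a\<close>,
      standing for the walk from \<open>u\<close> through \<open>v\<close> to \<open>h a\<close>
      along \<open>b\<close> and the old \<open>a\<close>.\<close>
    define t' where "t' = t(a := u)"
    define E'' where "E'' = E' - {a}"
    have E: "E = insert a (insert b E'')" "E' = insert a E''" "a \<notin> E''" "b \<notin> E''" "a \<noteq> b" "finite E''"
      using a b(1) Suc.prems(1) by (auto simp: E'_def E''_def)
    have t': "t' e = t e" if "e \<in> E''" for e using that E by (auto simp: t'_def)
    have "bit_flow E' t' h (\<lambda>_. 1)"
      unfolding bit_flow_def
    proof
      fix \<xi> :: "_ \<Rightarrow> bit"
      have "\<xi> (t b) + \<xi> (h b) = \<xi> v + \<xi> u" using ends by auto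
      then have "\<xi> v + \<xi> (h a) + (\<xi> v + \<xi> u + (\<Sum>e\<in>E''. \<xi> (t e) + \<xi> (h e))) = 0"
        using bit_flowD[OF Suc.prems(2), of \<xi>] E(3-) by (simp add: E(1) v_def)
      moreover have "\<xi> v + \<xi> (h a) + (\<xi> v + \<xi> u + r) = \<xi> u + \<xi> (h a) + r" for r
        by (cases "\<xi> v") (auto simp: add_ac)
      ultimately show "(\<Sum>e\<in>E'. 1 * (\<xi> (t' e) + \<xi> (h e))) = 0"
        using E(3-) t' by (simp add: E(2) t'_def)
    qed
    then obtain s where s: "\<forall>e\<in>E'. s e = 1 \<or> s e = -1" "int_flow E' t' h s"
      using Suc.hyps(1)[of E' t'] Suc.hyps(2)[symmetric] Suc.prems(1) b(1) by (auto simp: E'_def)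
    \<comment> \<open>\<open>b\<close> gets the sign that carries the value of \<open>a\<close> from
      \<open>u\<close> to \<open>v\<close>, negated if \<open>b\<close> points from \<open>v\<close>
      to \<open>u\<close>.\<close>
    define s' where "s' = s(b := if h b = v then s a else - s a)"
    have s'E: "s' e = s e" if "e \<in> E''" for e using that E by (auto simp: s'_def)
    have "int_flow E t h s'"
      unfolding int_flow_def
    proof
      fix \<xi> :: "_ \<Rightarrow> int"
      have "(\<Sum>e\<in>E. s' e * (\<xi> (t e) - \<xi> (h e))) =
          s a * (\<xi> v - \<xi> (h a)) + (s' b * (\<xi> (t b) - \<xi> (h b)) + (\<Sum>e\<in>E''. s e * (\<xi> (t e) - \<xi> (h e))))"
        using E(3-) s'E by (simp add: E(1) v_def s'_def)
      also have "s' b * (\<xi> (t b) - \<xi> (h b)) = s a * (\<xi> u - \<xi> v)"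
        using ends by (auto simp: s'_def algebra_simps)
      also have "s a * (\<xi> v - \<xi> (h a)) + (s a * (\<xi> u - \<xi> v) + (\<Sum>e\<in>E''. s e * (\<xi> (t e) - \<xi> (h e)))) =
          (\<Sum>e\<in>E'. s e * (\<xi> (t' e) - \<xi> (h e)))"
        using E(3-) t' by (simp add: E(2) t'_def algebra_simps)
      finally show "(\<Sum>e\<in>E. s' e * (\<xi> (t e) - \<xi> (h e))) = 0"
        using int_flowD[OF s(2)] by simp
    qed
    moreover have "\<forall>e\<in>E. s' e = 1 \<or> s' e = -1"
      using s(1) a b(1) by (auto simp: s'_def E'_def)
    ultimately show ?thesis by blast
  qed
qed

text \<open>The constant 1 is a Z_2-flow on the support of \<open>y\<close>, so the support can be
  signed; elsewhere the lift is 0.\<close>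

lemma bit_flow_signed_lift:
  assumes "finite E" "bit_flow E t h y"
  shows "\<exists>s. int_flow E t h s \<and> (\<forall>e\<in>E. (y e = 0 \<longrightarrow> s e = 0) \<and> (y e = 1 \<longrightarrow> s e = 1 \<or> s e = -1))"
proof -
  let ?F = "{e \<in> E. y e = 1}"
  have "(\<Sum>e\<in>?F. 1 * (\<xi> (t e) + \<xi> (h e))) = (\<Sum>e\<in>E. y e * (\<xi> (t e) + \<xi> (h e)))" for \<xi> :: "_ \<Rightarrow> bit"
    using assms(1) by (intro sum.mono_neutral_cong_left) auto
  then have "bit_flow ?F t h (\<lambda>_. 1)"
    using assms(2) by (simp add: bit_flow_def)
  then obtain s where s: "\<forall>e\<in>?F. s e = 1 \<or> s e = -1" "int_flow ?F t h s"
    using bit_flow_const_1_orientable[of ?F t h] assms(1) by auto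
  let ?s = "\<lambda>e. if y e = 1 then s e else 0"
  have "(\<Sum>e\<in>E. ?s e * (\<xi> (t e) - \<xi> (h e))) = (\<Sum>e\<in>?F. s e * (\<xi> (t e) - \<xi> (h e)))" for \<xi> :: "_ \<Rightarrow> int"
    using assms(1) by (intro sum.mono_neutral_cong_right) auto
  then have "int_flow E t h ?s"
    using s(2) by (simp add: int_flow_def)
  then show ?thesis using s(1) by (intro exI[of _ ?s]) auto
qed

text \<open>The first coordinate is the parity of \<open>g\<close>. Subtracting a flow
  \<open>s\<close> of the same parity with values 0 and +-1 makes \<open>g\<close> even everywhere
  and leaves it unchanged where it was even; half of the difference, mod 2, is the second
  coordinate.\<close>

lemma bit_flow_pair_of_int_flow:
  assumes fin: "finite E" and flow: "int_flow E t h g" and nz: "\<And>e. e \<in> E \<Longrightarrow> g e \<noteq> 0 \<and> \<bar>g e\<bar> < 4"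
  obtains y z where "bit_flow E t h y" "bit_flow E t h z" "\<And>e. e \<in> E \<Longrightarrow> y e \<noteq> 0 \<or> z e \<noteq> 0"
proof -
  define y where "y e = (of_int (g e) :: bit)" for e
  have y: "bit_flow E t h y" unfolding y_def by (rule bit_flow_of_int[OF flow])
  then obtain s where s: "int_flow E t h s" "\<And>e. e \<in> E \<Longrightarrow> (y e = 0 \<longrightarrow> s e = 0) \<and> (y e = 1 \<longrightarrow> s e = 1 \<or> s e = -1)"
    using bit_flow_signed_lift[OF fin] by blast
  have parity: "y e = 0 \<longleftrightarrow> even (g e)" for e by (simp add: y_def of_int_bit_eq_0_iff)
  \<comment> \<open>\<open>g = \<plusminus>2\<close> gives \<open>k = \<plusminus>1\<close>, so the parity of \<open>k\<close> covers the edges on which \<open>g\<close> is even.\<close>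
  define k where "k e = (g e - s e) div 2" for e
  have k: "2 * k e = g e + (-1) * s e" if "e \<in> E" for e
  proof -
    have "even (g e - s e)" using s(2)[OF that] parity[of e] by (cases "y e") auto
    then show ?thesis by (simp add: k_def)
  qed
  have "2 * (\<Sum>e\<in>E. k e * (\<xi> (t e) - \<xi> (h e))) = (\<Sum>e\<in>E. (g e + (-1) * s e) * (\<xi> (t e) - \<xi> (h e)))" for \<xi> :: "_ \<Rightarrow> int"
    unfolding sum_distrib_left by (rule sum.cong) (simp_all only: k[symmetric] mult.assoc)
  then have "int_flow E t h k"
    using int_flowD[OF int_flow_add[OF flow int_flow_mult[OF s(1), of "-1"]]]
    unfolding int_flow_def by (metis mult_eq_0_iff zero_neq_numeral)
  then have "bit_flow E t h (\<lambda>e. of_int (k e))" by (rule bit_flow_of_int)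
  moreover have "y e \<noteq> 0 \<or> (of_int (k e) :: bit) \<noteq> 0" if e: "e \<in> E" for e
  proof (cases "y e = 0")
    case True
    then have "even (g e)" "s e = 0" using parity s(2)[OF e] by auto
    then have "2 * k e = g e" using k[OF e] by simp
    moreover from this have "k e = 1 \<or> k e = -1" using nz[OF e] by presburger
    ultimately show ?thesis by auto
  qed simp
  ultimately show ?thesis using that y by blast
qed

text \<open>For \<open>p\<close> and \<open>q\<close> with values in {-1, 0, 1}, the flow
  \<open>p + 2 * q\<close> is at most 3 in absolute value, and its parity is that of
  \<open>p\<close>, so it vanishes only where both do.\<close>

lemma int_flow_of_bit_flow_pair:
  assumes "finite E" "bit_flow E t h y" "bit_flow E t h z"
  obtains f where "int_flow E t h f" "\<And>e. e \<in> E \<Longrightarrow> \<bar>f e\<bar> < 4" "\<And>e. e \<in> E \<Longrightarrow> f e = 0 \<longleftrightarrow> y e = 0 \<and> z e = 0"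
proof -
  obtain p where p: "int_flow E t h p" "\<And>e. e \<in> E \<Longrightarrow> (y e = 0 \<longrightarrow> p e = 0) \<and> (y e = 1 \<longrightarrow> p e = 1 \<or> p e = -1)"
    using bit_flow_signed_lift[OF assms(1,2)] by blast
  obtain q where q: "int_flow E t h q" "\<And>e. e \<in> E \<Longrightarrow> (z e = 0 \<longrightarrow> q e = 0) \<and> (z e = 1 \<longrightarrow> q e = 1 \<or> q e = -1)"
    using bit_flow_signed_lift[OF assms(1,3)] by blast
  show ?thesis
  proof (rule that[of "\<lambda>e. p e + 2 * q e"])
    show "int_flow E t h (\<lambda>e. p e + 2 * q e)"
      by (rule int_flow_add[OF p(1) int_flow_mult[OF q(1)]])
    fix e assume e: "e \<in> E"
    show "\<bar>p e + 2 * q e\<bar> < 4" "p e + 2 * q e = 0 \<longleftrightarrow> y e = 0 \<and> z e = 0"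
      using p(2)[OF e] q(2)[OF e] by (cases "y e"; cases "z e"; auto)+
  qed
qed

section \<open>Conservation at vertices, and contraction\<close>

lemma is_flow_iff_int_flow:
  assumes "fin_multigraph G" "orientation_of D G"
  shows "is_flow G D f \<longleftrightarrow> int_flow (medges G) (tail D) (head D) f"
proof -
  interpret fin_multigraph G by fact
  have D: "arcs D = medges G" "verts D = mverts G" using assms(2) by (auto simp: orientation_of_def)
  have ends: "tail D e \<in> mverts G" "head D e \<in> mverts G" if "e \<in> medges G" for e
    using that assms(2) ends_in_mverts[OF that] by (auto simp: orientation_of_def)
  have out: "(\<Sum>e\<in>out_arcs D v. f e) = (\<Sum>e\<in>medges G. f e * of_bool (tail D e = v))" for v
    unfolding out_arcs_def D by (rule sum.mono_neutral_cong_left) (use finite_medges in auto)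
  have inn: "(\<Sum>e\<in>in_arcs D v. f e) = (\<Sum>e\<in>medges G. f e * of_bool (head D e = v))" for v
    unfolding in_arcs_def D by (rule sum.mono_neutral_cong_left) (use finite_medges in auto)
  have diff: "(\<Sum>e\<in>out_arcs D v. f e) - (\<Sum>e\<in>in_arcs D v. f e) =
      (\<Sum>e\<in>medges G. f e * (of_bool (tail D e = v) - of_bool (head D e = v)))" for v
    by (simp add: out inn sum_subtractf right_diff_distrib)
  show ?thesis
  proof
    assume flow: "is_flow G D f"
    show "int_flow (medges G) (tail D) (head D) f"
      unfolding int_flow_def
    proof
      fix \<xi> :: "_ \<Rightarrow> int"
      \<comment> \<open>At the ends of edges a test function is a combination of indicators of
        vertices, and pairing with an indicator is conservation at that vertex.\<close>
      have expand: "\<xi> u = (\<Sum>v\<in>mverts G. of_bool (u = v) * \<xi> v)" if "u \<in> mverts G" for u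
        using that finite_mverts by (simp add: of_bool_def if_distrib[of "\<lambda>x. x * _"] cong: if_cong)
      have "(\<Sum>e\<in>medges G. f e * (\<xi> (tail D e) - \<xi> (head D e))) =
          (\<Sum>e\<in>medges G. \<Sum>v\<in>mverts G. \<xi> v * (f e * (of_bool (tail D e = v) - of_bool (head D e = v))))"
      proof (rule sum.cong)
        fix e assume e: "e \<in> medges G"
        show "f e * (\<xi> (tail D e) - \<xi> (head D e)) =
          (\<Sum>v\<in>mverts G. \<xi> v * (f e * (of_bool (tail D e = v) - of_bool (head D e = v))))"
          unfolding expand[OF ends(1)[OF e]] expand[OF ends(2)[OF e]]
          by (simp add: sum_distrib_left flip: sum_subtractf) (simp add: algebra_simps)
      qed simp
      also have "\<dots> = (\<Sum>v\<in>mverts G. \<xi> v * ((\<Sum>e\<in>out_arcs D v. f e) - (\<Sum>e\<in>in_arcs D v. f e)))"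
        unfolding diff sum_distrib_left by (rule sum.swap)
      also have "\<dots> = 0"
        using flow by (intro sum.neutral) (simp add: is_flow_def)
      finally show "(\<Sum>e\<in>medges G. f e * (\<xi> (tail D e) - \<xi> (head D e))) = 0" .
    qed
  next
    assume "int_flow (medges G) (tail D) (head D) f"
    then have "(\<Sum>e\<in>out_arcs D v. f e) - (\<Sum>e\<in>in_arcs D v. f e) = 0" for v
      using int_flowD[of _ _ _ f "\<lambda>u. of_bool (u = v)"] by (simp only: diff)
    then show "is_flow G D f"
      using assms(2) by (simp add: is_flow_def)
  qed
qed

text \<open>A function constant along \<open>F\<close> is constant on the classes, so it descends to
  the contracted graph, where \<open>y\<close> pairs to 0 with it. In dual form, contraction just
  restricts the test functions.\<close>

lemma bit_flow_contract:
  assumes F: "F \<subseteq> medges G"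
    and orient: "\<And>e. e \<in> medges G \<Longrightarrow> mends G e = Upair (t e) (h e)"
    and D: "orientation_of D (contract G F)"
    and flow: "bit_flow (medges G - F) (tail D) (head D) y"
    and fin: "fin_multigraph G"
    and \<xi>: "\<And>e. e \<in> F \<Longrightarrow> \<xi> (t e) = \<xi> (h e)"
  shows "(\<Sum>e\<in>medges G - F. y e * (\<xi> (t e) + \<xi> (h e))) = 0"
proof -
  let ?cls = "\<lambda>v. joined_by G F `` {v}"
  have const: "\<xi> w = \<xi> v" if "(v, w) \<in> joined_by G F" for v w
  proof -
    have "(v, w) \<in> (adjacency (G\<lparr>medges := medges G \<inter> F\<rparr>))\<^sup>*"
      using that by (simp add: joined_by_def)
    then show ?thesis
    proof induction
      case (step u w)
      then obtain e where "e \<in> medges G \<inter> F" "mends G e = Upair u w"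
        by (auto simp: adjacency_def)
      then show ?case using orient[of e] \<xi>[of e] step.IH by auto
    qed simp
  qed
  define \<zeta> where "\<zeta> W = \<xi> (SOME w. w \<in> W)" for W
  have \<zeta>: "\<zeta> (?cls v) = \<xi> v" if "v \<in> mverts G" for v
  proof -
    have "v \<in> ?cls v" using that by (auto simp: joined_by_def)
    then have "(SOME w. w \<in> ?cls v) \<in> ?cls v" by (rule someI)
    then show ?thesis by (auto simp: \<zeta>_def intro: const)
  qed
  have "\<zeta> (tail D e) + \<zeta> (head D e) = \<xi> (t e) + \<xi> (h e)" if e: "e \<in> medges G - F" for e
  proof -
    \<comment> \<open>\<open>D\<close> may direct \<open>e\<close> opposite to \<open>t\<close> and
      \<open>h\<close>; comparing the unordered pairs of ends suffices mod 2.\<close>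
    have "Upair (tail D e) (head D e) = Upair (?cls (t e)) (?cls (h e))"
      using D e orient[of e] by (auto simp: orientation_of_def contract_def simp del: Upair_inject dest!: bspec[of _ _ e])
    moreover have "t e \<in> mverts G" "h e \<in> mverts G"
      using fin_multigraph.ends_in_mverts[OF fin, of e] orient[of e] e by auto
    ultimately show ?thesis using \<zeta> by (auto simp: add.commute)
  qed
  then show ?thesis using bit_flowD[OF flow, of \<zeta>] by simp
qed

section \<open>Circuits\<close>

lemma ex_edge_ends: "\<exists>t h. \<forall>e. mends G e = Upair (t e) (h e)"
proof -
  have "\<exists>a b. mends G e = Upair a b" for e
    by (cases "mends G e") auto
  then show ?thesis by metis
qed

lemma mdegree_eq:
  assumes "fin_multigraph G" "\<And>e. e \<in> medges G \<Longrightarrow> mends G e = Upair (t e) (h e)"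
  shows "mdegree G v = card {e \<in> medges G. t e = v} + card {e \<in> medges G. h e = v}"
proof -
  have fin: "finite (medges G)" using assms(1) by (simp add: fin_multigraph_def)
  have "{e \<in> medges G. v \<in> set_uprod (mends G e)} = {e \<in> medges G. t e = v} \<union> {e \<in> medges G. h e = v}"
    "{e \<in> medges G. mends G e = Upair v v} = {e \<in> medges G. t e = v} \<inter> {e \<in> medges G. h e = v}"
    using assms(2) by auto
  then show ?thesis
    using fin card_Un_Int[of "{e \<in> medges G. t e = v}" "{e \<in> medges G. h e = v}"] by (simp add: mdegree_def)
qed

text \<open>By 2-regularity the constant 1 is a Z_2-flow. The signs from
  \<open>bit_flow_const_1_orientable\<close> redirect the edges so that indegree and outdegree
  agree, and they add up to 2.\<close>

lemma circuit_orientation: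
  assumes "circuit C"
  obtains t h where "\<And>e. e \<in> medges C \<Longrightarrow> mends C e = Upair (t e) (h e)"
    and "\<And>v. v \<in> mverts C \<Longrightarrow> card {e \<in> medges C. t e = v} = 1"
    and "\<And>v. v \<in> mverts C \<Longrightarrow> card {e \<in> medges C. h e = v} = 1"
proof -
  interpret fin_multigraph C using assms by (simp add: circuit_def)
  let ?E = "medges C"
  obtain t h where th: "\<And>e. mends C e = Upair (t e) (h e)"
    using ex_edge_ends[of C] by blast
  have ends: "t e \<in> mverts C" "h e \<in> mverts C" if "e \<in> ?E" for e
    using ends_in_mverts[OF that] th[of e] by auto
  have sum_card: "(\<Sum>e\<in>?E. of_bool (k e = v)) = of_nat (card {e \<in> ?E. k e = v})" for k and v :: 'a
    using finite_medges by (simp add: Int_def)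
  have deg: "card {e \<in> ?E. t e = v} + card {e \<in> ?E. h e = v} = 2" if "v \<in> mverts C" for v
    using assms that mdegree_eq[OF fin_multigraph_axioms, of t h v] th by (simp add: circuit_def)
  have "bit_flow ?E t h (\<lambda>_. 1)"
    unfolding bit_flow_def
  proof
    fix \<xi> :: "'a \<Rightarrow> bit"
    have expand: "\<xi> u = (\<Sum>v\<in>mverts C. \<xi> v * of_bool (u = v))" if "u \<in> mverts C" for u
      using that finite_mverts by (simp add: of_bool_def if_distrib[of "\<lambda>x. _ * x"] cong: if_cong)
    have "(\<Sum>e\<in>?E. 1 * (\<xi> (t e) + \<xi> (h e))) =
        (\<Sum>e\<in>?E. \<Sum>v\<in>mverts C. \<xi> v * (of_bool (t e = v) + of_bool (h e = v)))"
    proof (rule sum.cong)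
      fix e assume e: "e \<in> ?E"
      show "1 * (\<xi> (t e) + \<xi> (h e)) = (\<Sum>v\<in>mverts C. \<xi> v * (of_bool (t e = v) + of_bool (h e = v)))"
        unfolding expand[OF ends(1)[OF e]] expand[OF ends(2)[OF e]] by (simp add: distrib_left sum.distrib)
    qed simp
    also have "\<dots> = (\<Sum>v\<in>mverts C. \<xi> v * (of_nat (card {e \<in> ?E. t e = v} + card {e \<in> ?E. h e = v})))"
      unfolding of_nat_add sum_card[symmetric] sum.distrib[symmetric] sum_distrib_left by (rule sum.swap)
    also have "\<dots> = 0" by (intro sum.neutral) (simp add: deg del: of_nat_add)
    finally show "(\<Sum>e\<in>?E. 1 * (\<xi> (t e) + \<xi> (h e))) = 0" .
  qed
  then obtain s :: "'b \<Rightarrow> int" where s: "\<And>e. e \<in> ?E \<Longrightarrow> s e = 1 \<or> s e = -1" "int_flow ?E t h s"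
    using bit_flow_const_1_orientable[OF finite_medges] by blast
  define t' where "t' e = (if s e = 1 then t e else h e)" for e
  define h' where "h' e = (if s e = 1 then h e else t e)" for e
  have "card {e \<in> ?E. t' e = v} = card {e \<in> ?E. h' e = v}" for v
  proof -
    have "(0 :: int) = (\<Sum>e\<in>?E. s e * (of_bool (t e = v) - of_bool (h e = v)))"
      using int_flowD[OF s(2), of "\<lambda>u. of_bool (u = v)"] by simp
    also have "\<dots> = (\<Sum>e\<in>?E. of_bool (t' e = v) - of_bool (h' e = v))"
      using s(1) by (intro sum.cong) (auto simp: t'_def h'_def)
    also have "\<dots> = int (card {e \<in> ?E. t' e = v}) - int (card {e \<in> ?E. h' e = v})"
      by (simp only: sum_subtractf sum_card)
    finally show ?thesis by simp
  qed
  moreover have *: "mends C e = Upair (t' e) (h' e)" for e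
    using th[of e] by (auto simp: t'_def h'_def)
  moreover have "card {e \<in> ?E. t' e = v} + card {e \<in> ?E. h' e = v} = 2" if "v \<in> mverts C" for v
    using assms that mdegree_eq[OF fin_multigraph_axioms, of t' h' v] * by (simp add: circuit_def)
  ultimately have "card {e \<in> ?E. t' e = v} = 1" "card {e \<in> ?E. h' e = v} = 1" if "v \<in> mverts C" for v
    using that by force+
  then show ?thesis using that[of t' h'] * by blast
qed

text \<open>With indegree and outdegree 1 the successor map on vertices is injective, so the orbit
  of \<open>r\<close> returns to \<open>r\<close>. It is closed under adjacency, hence by
  connectedness contains every vertex.\<close>

lemma circuit_enumeration:
  assumes "circuit C"
  obtains v :: "nat \<Rightarrow> 'v" and d :: "nat \<Rightarrow> 'e"
  where "card (medges (C :: ('v, 'e) multigraph)) > 0"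
    and "bij_betw d {..<card (medges C)} (medges C)"
    and "bij_betw v {..<card (medges C)} (mverts C)"
    and "v (card (medges C)) = v 0"
    and "\<And>i. mends C (d i) = Upair (v i) (v (Suc i))"
proof -
  interpret fin_multigraph C using assms by (simp add: circuit_def)
  let ?E = "medges C" and ?V = "mverts C"
  obtain t h where th: "\<And>e. e \<in> ?E \<Longrightarrow> mends C e = Upair (t e) (h e)"
    and out: "\<And>v. v \<in> ?V \<Longrightarrow> card {e \<in> ?E. t e = v} = 1"
    and inn: "\<And>v. v \<in> ?V \<Longrightarrow> card {e \<in> ?E. h e = v} = 1"
    using circuit_orientation[OF assms] by blast
  have ends: "t e \<in> ?V" "h e \<in> ?V" if "e \<in> ?E" for e
    using ends_in_mverts[OF that] th[OF that] by auto
  have t_inj: "e = e'" if "e \<in> ?E" "e' \<in> ?E" "t e = t e'" for e e'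
    using card_1_singletonE[OF out[OF ends(1)[OF that(1)]]] that
    by (metis (mono_tags, lifting) mem_Collect_eq singletonD)
  have h_inj: "e = e'" if "e \<in> ?E" "e' \<in> ?E" "h e = h e'" for e e'
    using card_1_singletonE[OF inn[OF ends(2)[OF that(1)]]] that
    by (metis (mono_tags, lifting) mem_Collect_eq singletonD)
  have "\<exists>e. e \<in> ?E \<and> t e = u" if "u \<in> ?V" for u
    using card_1_singletonE[OF out[OF that]] by (metis (mono_tags, lifting) mem_Collect_eq singletonI)
  then obtain g where g: "\<And>u. u \<in> ?V \<Longrightarrow> g u \<in> ?E \<and> t (g u) = u" by metis
  obtain r where r: "r \<in> ?V" using assms by (auto simp: circuit_def mconnected_def)
  define v where "v i = ((\<lambda>u. h (g u)) ^^ i) r" for i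
  have v_Suc: "v (Suc i) = h (g (v i))" for i by (simp add: v_def)
  have vV: "v i \<in> ?V" for i
  proof (induction i)
    case (Suc i)
    then show ?case using g ends by (simp add: v_Suc)
  qed (simp add: v_def r)
  \<comment> \<open>Injectivity moves any repetition back to position 0.\<close>
  have shift_down: "v i = v j \<Longrightarrow> v 0 = v (j - i)" if "i \<le> j" for i j
    using that
  proof (induction i arbitrary: j)
    case (Suc i)
    then obtain j' where j: "j = Suc j'" by (cases j) auto
    have "g (v i) = g (v j')"
      using Suc.prems g[OF vV] h_inj unfolding j v_Suc by blast
    then have "v i = v j'" using g[OF vV] by metis
    then show ?case using Suc.IH[of j'] Suc.prems j by simp
  qed simp
  have "\<not> inj v" using finite_mverts vV by (meson finite_subset image_subsetI infinite_UNIV_nat finite_imageD)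
  then obtain i j where "i < j" "v i = v j" unfolding inj_def by (metis linorder_neqE_nat)
  then have ex: "\<exists>k>0. v k = v 0" using shift_down[of i j] by (intro exI[of _ "j - i"]) auto
  define k where "k = (LEAST k. k > 0 \<and> v k = v 0)"
  have k: "k > 0" "v k = v 0" using LeastI_ex[OF ex] by (auto simp: k_def)
  have min: "v j \<noteq> v 0" if "0 < j" "j < k" for j
    using not_less_Least[of j "\<lambda>k. k > 0 \<and> v k = v 0"] that by (auto simp: k_def)
  have ne: "v i \<noteq> v j" if "i < j" "j < k" for i j
    using shift_down[of i j] min[of "j - i"] that by (auto simp: less_imp_diff_less)
  have inj: "inj_on v {..<k}"
  proof (rule inj_onI)
    fix i j assume "i \<in> {..<k}" "j \<in> {..<k}" "v i = v j"
    then show "i = j" using ne[of i j] ne[of j i] by (cases i j rule: linorder_cases) auto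
  qed
  let ?S = "v ` {..<k}"
  have Suc_S: "v (Suc i) \<in> ?S" if "i < k" for i
    using that k by (cases "Suc i = k") (auto intro: image_eqI[of _ _ 0])
  have closed: "w \<in> ?S" if prems: "u \<in> ?S" "e \<in> ?E" "mends C e = Upair u w" for u w e
  proof -
    obtain i where i: "i < k" "u = v i" using prems(1) by blast
    consider "t e = u" "h e = w" | "h e = u" "t e = w"
      using prems th[of e] by auto
    then show ?thesis
    proof cases
      case 1
      then have "e = g u" using t_inj[of e "g u"] g[of u] vV i prems by auto
      then show ?thesis using Suc_S[OF i(1)] 1 i by (simp add: v_Suc)
    next
      case 2
      obtain j where j: "j < k" "u = v (Suc j)"
      proof (cases i)
        case 0
        then show ?thesis using that[of "k - 1"] k i by simp
      next
        case (Suc j)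
        then show ?thesis using that[of j] i by simp
      qed
      then have "e = g (v j)" using h_inj[of e "g (v j)"] g[OF vV, of j] prems 2 by (simp add: v_Suc)
      then show ?thesis using g[OF vV, of j] 2 j by auto
    qed
  qed
  have "w \<in> ?S" if "w \<in> ?V" for w
  proof -
    have "(r, w) \<in> (adjacency C)\<^sup>*" using assms that r by (simp add: circuit_def mconnected_def)
    then show ?thesis
    proof induction
      case base
      show ?case using k by (auto simp: v_def intro!: image_eqI[of _ _ 0])
    next
      case (step u w)
      then obtain e where "e \<in> ?E" "mends C e = Upair u w" by (auto simp: adjacency_def)
      then show ?case using closed[OF step.IH] by blast
    qed
  qed
  then have bv: "bij_betw v {..<k} ?V" using inj vV by (auto simp: bij_betw_def)
  have "bij_betw g ?V ?E"
  proof (rule bij_betwI')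
    show "(g x = g y) = (x = y)" if "x \<in> ?V" "y \<in> ?V" for x y using g that by metis
    show "g x \<in> ?E" if "x \<in> ?V" for x using g that by blast
    show "\<exists>x\<in>?V. e = g x" if "e \<in> ?E" for e
      using t_inj[OF that, of "g (t e)"] g[OF ends(1)[OF that]] ends(1)[OF that] by auto
  qed
  then have bd: "bij_betw (\<lambda>i. g (v i)) {..<k} ?E"
    using bij_betw_trans[OF bv] by (simp add: o_def)
  then have card: "card ?E = k" using bij_betw_same_card by fastforce
  have "mends C (g (v i)) = Upair (v i) (v (Suc i))" for i
    using th[of "g (v i)"] g[OF vV, of i] by (simp add: v_Suc)
  then show ?thesis using that[of "\<lambda>i. g (v i)" v] bv bd k unfolding card by blast
qed

section \<open>Z_2-flows around an enumerated circuit\<close>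

lemma sum_bit_by_parts:
  fixes b \<phi> :: "nat \<Rightarrow> bit"
  shows "(\<Sum>i<n. (\<Sum>j\<le>i. b j) * (\<phi> i + \<phi> (Suc i))) = (\<Sum>i<n. b i * \<phi> i) + (\<Sum>j<n. b j) * \<phi> n"
proof (induction n)
  case (Suc n)
  have "s * p + (s + c) * (p + q) = c * p + (s + c) * q" for s p c q :: bit
    by (cases s; cases p; cases c; cases q) auto
  from this[of "\<Sum>j<n. b j" "\<phi> n" "b n" "\<phi> (Suc n)"] Suc show ?case
    by (simp add: lessThan_Suc_atMost[symmetric] add.assoc)
qed simp

text \<open>The ends of \<open>d i\<close> are prescribed only up to order, as befits coefficients
  in Z_2. Position \<open>m\<close> repeats position 0, which also accommodates a loop
  (\<open>m = 1\<close>) and a parallel pair (\<open>m = 2\<close>).\<close>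

locale enumerated_circuit =
  fixes E K :: "'e set" and t h :: "'e \<Rightarrow> 'v" and m :: nat and v :: "nat \<Rightarrow> 'v" and d :: "nat \<Rightarrow> 'e"
  assumes finite_E: "finite E"
    and K_subset: "K \<subseteq> E"
    and m_pos: "m > 0"
    and d_bij: "bij_betw d {..<m} K"
    and v_inj: "inj_on v {..<m}"
    and v_m: "v m = v 0"
    and d_ends: "i < m \<Longrightarrow> (t (d i) = v i \<and> h (d i) = v (Suc i)) \<or> (t (d i) = v (Suc i) \<and> h (d i) = v i)"
begin

lemma d_in_K: "i < m \<Longrightarrow> d i \<in> K"
  using d_bij by (auto simp: bij_betw_def)

lemma d_eq_iff: "i < m \<Longrightarrow> j < m \<Longrightarrow> d i = d j \<longleftrightarrow> i = j"
  using d_bij by (auto simp: bij_betw_def inj_on_def)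

lemma sum_K: "(\<Sum>e\<in>K. y e * (\<xi> (t e) + \<xi> (h e))) = (\<Sum>i<m. y (d i) * (\<xi> (v i) + \<xi> (v (Suc i))) :: bit)"
proof -
  have "(\<Sum>e\<in>K. y e * (\<xi> (t e) + \<xi> (h e))) = (\<Sum>i<m. y (d i) * (\<xi> (t (d i)) + \<xi> (h (d i))))"
    by (rule sum.reindex_bij_betw[OF d_bij, symmetric])
  also have "\<dots> = (\<Sum>i<m. y (d i) * (\<xi> (v i) + \<xi> (v (Suc i))))"
  proof (rule sum.cong)
    fix i assume "i \<in> {..<m}"
    then show "y (d i) * (\<xi> (t (d i)) + \<xi> (h (d i))) = y (d i) * (\<xi> (v i) + \<xi> (v (Suc i)))"
      using d_ends[of i] by (auto simp: add.commute)
  qed simp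
  finally show ?thesis .
qed

lemma sum_E: "(\<Sum>e\<in>E. y e * (\<xi> (t e) + \<xi> (h e))) =
    (\<Sum>e\<in>E - K. y e * (\<xi> (t e) + \<xi> (h e))) + (\<Sum>i<m. y (d i) * (\<xi> (v i) + \<xi> (v (Suc i))) :: bit)"
  unfolding sum_K[symmetric] by (rule sum.subset_diff[OF K_subset finite_E])

text \<open>Conservation dictates that the value on the circuit changes at \<open>v j\<close> by the
  boundary \<open>b j\<close> of \<open>y\<close>. Prefix sums of \<open>b\<close> do this, and they
  close up because \<open>y\<close> pairs to 0 with the indicator of the circuit's vertices.\<close>

lemma bit_flow_extend:
  assumes y: "\<And>\<xi> :: 'v \<Rightarrow> bit. (\<And>i. i < m \<Longrightarrow> \<xi> (v i) = \<xi> (v 0)) \<Longrightarrow>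
      (\<Sum>e\<in>E - K. y e * (\<xi> (t e) + \<xi> (h e))) = 0"
  obtains z where "bit_flow E t h z" "\<And>e. e \<in> E - K \<Longrightarrow> z e = y e"
proof -
  define b where "b j = (\<Sum>e\<in>E - K. y e * (of_bool (t e = v j) + of_bool (h e = v j)))" for j
  define z where "z e = (if e \<in> K then \<Sum>j\<le>the_inv_into {..<m} d e. b j else y e)" for e
  have z_d: "z (d i) = (\<Sum>j\<le>i. b j)" if "i < m" for i
    using that d_in_K the_inv_into_f_f[of d "{..<m}" i] d_bij by (simp add: z_def bij_betw_def)
  let ?V = "v ` {..<m}"
  have sum_b: "(\<Sum>j<m. b j * \<xi> (v j)) =
      (\<Sum>e\<in>E - K. y e * ((if t e \<in> ?V then \<xi> (t e) else 0) + (if h e \<in> ?V then \<xi> (h e) else 0)))" for \<xi> :: "'v \<Rightarrow> bit"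
  proof -
    have expand: "(\<Sum>j<m. of_bool (p = v j) * \<xi> (v j)) = (if p \<in> ?V then \<xi> p else 0)" for p
    proof (cases "p \<in> ?V")
      case True
      then obtain k where k: "k < m" "p = v k" by blast
      then have "(\<Sum>j<m. of_bool (p = v j) * \<xi> (v j)) = (\<Sum>j<m. if j = k then \<xi> (v k) else 0)"
        using v_inj by (intro sum.cong) (auto simp: inj_on_def)
      then show ?thesis using k by simp
    qed (auto intro!: sum.neutral)
    have "(\<Sum>j<m. b j * \<xi> (v j)) =
        (\<Sum>j<m. \<Sum>e\<in>E - K. y e * (of_bool (t e = v j) * \<xi> (v j) + of_bool (h e = v j) * \<xi> (v j)))"
      by (simp add: b_def sum_distrib_right mult.assoc distrib_right)
    also have "\<dots> = (\<Sum>e\<in>E - K. \<Sum>j<m. y e * (of_bool (t e = v j) * \<xi> (v j) + of_bool (h e = v j) * \<xi> (v j)))"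
      by (rule sum.swap)
    also have "\<dots> = (\<Sum>e\<in>E - K. y e * ((if t e \<in> ?V then \<xi> (t e) else 0) + (if h e \<in> ?V then \<xi> (h e) else 0)))"
      by (simp only: sum_distrib_left[symmetric] sum.distrib expand)
    finally show ?thesis .
  qed
  have total: "(\<Sum>j<m. b j) = 0"
    using sum_b[of "\<lambda>_. 1"] y[of "\<lambda>p. if p \<in> ?V then 1 else 0"] m_pos by simp
  have "bit_flow E t h z"
    unfolding bit_flow_def
  proof
    fix \<xi> :: "'v \<Rightarrow> bit"
    have "(\<Sum>e\<in>E. z e * (\<xi> (t e) + \<xi> (h e))) =
        (\<Sum>e\<in>E - K. y e * (\<xi> (t e) + \<xi> (h e))) + (\<Sum>i<m. (\<Sum>j\<le>i. b j) * (\<xi> (v i) + \<xi> (v (Suc i))))"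
      unfolding sum_E using z_d by (simp add: z_def)
    also have "(\<Sum>i<m. (\<Sum>j\<le>i. b j) * (\<xi> (v i) + \<xi> (v (Suc i)))) = (\<Sum>j<m. b j * \<xi> (v j))"
      using sum_bit_by_parts[of b "\<lambda>i. \<xi> (v i)" m] total by simp
    \<comment> \<open>The circuit edges cancel the part of \<open>\<xi>\<close> on the circuit's
      vertices; the rest is 0 on all of them, so the hypothesis on \<open>y\<close> applies.\<close>
    also have "(\<Sum>e\<in>E - K. y e * (\<xi> (t e) + \<xi> (h e))) + (\<Sum>j<m. b j * \<xi> (v j)) =
        (\<Sum>e\<in>E - K. y e * ((if t e \<in> ?V then 0 else \<xi> (t e)) + (if h e \<in> ?V then 0 else \<xi> (h e))))"
      unfolding sum_b sum.distrib[symmetric] distrib_left[symmetric]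
    proof (rule sum.cong)
      fix e
      have "p + q + ((if P then p else 0) + (if Q then q else 0)) = (if P then 0 else p) + (if Q then 0 else q)" for p q :: bit and P Q
        by (cases p; cases q) auto
      then show "y e * (\<xi> (t e) + \<xi> (h e) + ((if t e \<in> ?V then \<xi> (t e) else 0) + (if h e \<in> ?V then \<xi> (h e) else 0))) =
          y e * ((if t e \<in> ?V then 0 else \<xi> (t e)) + (if h e \<in> ?V then 0 else \<xi> (h e)))"
        by simp
    qed simp
    also have "\<dots> = 0"
      using y[of "\<lambda>p. if p \<in> ?V then 0 else \<xi> p"] m_pos by auto
    finally show "(\<Sum>e\<in>E. z e * (\<xi> (t e) + \<xi> (h e))) = 0" .
  qed
  then show ?thesis using that[of z] by (auto simp: z_def)
qed

definition arc :: "nat \<Rightarrow> nat \<Rightarrow> 'e \<Rightarrow> bit" where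
  "arc u w e = of_bool (e \<in> d ` {u..<w})"

lemma arc_d: "i < m \<Longrightarrow> w \<le> m \<Longrightarrow> arc u w (d i) = of_bool (u \<le> i \<and> i < w)"
  using d_eq_iff by (auto simp: arc_def)

lemma arc_outside: "w \<le> m \<Longrightarrow> e \<notin> K \<Longrightarrow> arc u w e = 0"
  using d_in_K by (auto simp: arc_def)

text \<open>The case \<open>w = m\<close> matters: \<open>arc 0 m\<close> is the whole circuit and
  has boundary 0 by \<open>v_m\<close>, as \<open>states_shift\<close> requires.\<close>

lemma arc_boundary:
  assumes "u \<le> w" "w \<le> m"
  shows "(\<Sum>e\<in>E. arc u w e * (\<xi> (t e) + \<xi> (h e))) = (\<xi> (v u) + \<xi> (v w) :: bit)"
proof -
  have "(\<Sum>e\<in>E. arc u w e * (\<xi> (t e) + \<xi> (h e))) = (\<Sum>i<m. of_bool (u \<le> i \<and> i < w) * (\<xi> (v i) + \<xi> (v (Suc i))))"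
    unfolding sum_E using assms by (simp add: arc_d arc_outside)
  also have "\<dots> = (\<Sum>i\<in>{u..<w}. \<xi> (v i) + \<xi> (v (Suc i)))"
    using assms by (intro sum.mono_neutral_cong_right) auto
  also have "\<dots> = \<xi> (v u) + \<xi> (v w)"
    using sum_bit_telescope[OF assms(1), of "\<lambda>i. \<xi> (v i)"] .
  finally show ?thesis .
qed

section \<open>Kempe changes of flows in Z_2 x Z_2\<close>

definition states :: "('e \<Rightarrow> bit \<times> bit) set" where
  "states = {x. bit_flow E t h (\<lambda>e. fst (x e)) \<and> bit_flow E t h (\<lambda>e. snd (x e)) \<and> (\<forall>e\<in>E - K. x e \<noteq> 0)}"

text \<open>With values as colours, these edges carry the two colours outside {0, c}, which adding
  \<open>c\<close> exchanges, as in a Kempe chain.\<close>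

definition kempe :: "('e \<Rightarrow> bit \<times> bit) \<Rightarrow> bit \<times> bit \<Rightarrow> ('v \<times> 'v) set" where
  "kempe x c = {(p, q). \<exists>e\<in>E - K. form c (x e) = 1 \<and> ((t e = p \<and> h e = q) \<or> (t e = q \<and> h e = p))}"

text \<open>\<open>k\<close> is the mod 2 sum of the edges of a walk from \<open>p\<close> to
  \<open>q\<close>; repeated edges cancel, so no simple path has to be chosen.\<close>

lemma kempe_path:
  assumes "(p, q) \<in> (kempe x c)\<^sup>*"
  shows "\<exists>k. (\<forall>e. k e \<noteq> 0 \<longrightarrow> e \<in> E - K \<and> form c (x e) = 1) \<and>
    (\<forall>\<xi>. (\<Sum>e\<in>E. k e * (\<xi> (t e) + \<xi> (h e))) = (\<xi> p + \<xi> q :: bit))"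
  using assms
proof induction
  case base
  show ?case by (intro exI[of _ "\<lambda>_. 0"]) simp
next
  case (step q r)
  then obtain k where k: "\<forall>e. k e \<noteq> 0 \<longrightarrow> e \<in> E - K \<and> form c (x e) = 1"
    "\<And>\<xi>. (\<Sum>e\<in>E. k e * (\<xi> (t e) + \<xi> (h e))) = (\<xi> p + \<xi> q :: bit)"
    by blast
  obtain a where a: "a \<in> E - K" "form c (x a) = 1" "(t a = q \<and> h a = r) \<or> (t a = r \<and> h a = q)"
    using step.hyps(2) by (auto simp: kempe_def)
  define k' where "k' e = k e + of_bool (e = a)" for e
  have "(\<Sum>e\<in>E. k' e * (\<xi> (t e) + \<xi> (h e))) = \<xi> p + \<xi> r" for \<xi> :: "'v \<Rightarrow> bit"
  proof -
    have "(\<Sum>e\<in>E. k' e * (\<xi> (t e) + \<xi> (h e))) = (\<xi> p + \<xi> q) + (\<Sum>e\<in>E. if e = a then \<xi> (t e) + \<xi> (h e) else 0)"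
      unfolding k(2)[symmetric] sum.distrib[symmetric] by (rule sum.cong) (auto simp: k'_def distrib_right)
    also have "\<dots> = (\<xi> p + \<xi> q) + (\<xi> q + \<xi> r)"
      using a finite_E by (auto simp: add.commute)
    also have "\<dots> = \<xi> p + \<xi> r" by (cases "\<xi> q") (auto simp: add_ac)
    finally show ?thesis .
  qed
  moreover have "\<forall>e. k' e \<noteq> 0 \<longrightarrow> e \<in> E - K \<and> form c (x e) = 1"
    using k(1) a by (auto simp: k'_def)
  ultimately show ?case by blast
qed

lemma states_add:
  assumes x: "x \<in> states" and k: "bit_flow E t h k"
    and nz: "\<And>e. e \<in> E - K \<Longrightarrow> k e = 1 \<Longrightarrow> x e \<noteq> c"
  shows "(\<lambda>e. x e + (if k e = 1 then c else 0)) \<in> states"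
proof -
  have *: "x e + (if k e = 1 then c else 0) = (fst (x e) + fst c * k e, snd (x e) + snd c * k e)" for e
    by (cases "k e") (auto simp: prod_eq_iff)
  have "x e + (if k e = 1 then c else 0) \<noteq> 0" if "e \<in> E - K" for e
  proof (cases "k e = 1")
    case True
    have "r + s = 0 \<longleftrightarrow> r = s" for r s :: "bit \<times> bit"
      by (simp add: prod_eq_iff bit_add_eq_0_iff)
    then show ?thesis using nz[OF that True] True by simp
  qed (use x that in \<open>simp add: states_def\<close>)
  then show ?thesis
    using x bit_flow_add[OF _ bit_flow_mult[OF k]] by (simp add: states_def *)
qed

text \<open>Path and arc have the same boundary, so their sum is a Z_2-flow. On the path
  \<open>form c (x e) = 1\<close> excludes the value \<open>c\<close>, so adding \<open>c\<close>
  creates no zero off the circuit.\<close>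

lemma kempe_swap:
  assumes x: "x \<in> states" and c: "c \<noteq> 0" and link: "(v u, v w) \<in> (kempe x c)\<^sup>*" and uw: "u \<le> w" "w < m"
  shows "\<exists>y\<in>states. \<forall>i<m. y (d i) = x (d i) + (if u \<le> i \<and> i < w then c else 0)"
proof -
  obtain k where k: "\<And>e. k e \<noteq> 0 \<Longrightarrow> e \<in> E - K \<and> form c (x e) = 1"
    "\<And>\<xi>. (\<Sum>e\<in>E. k e * (\<xi> (t e) + \<xi> (h e))) = (\<xi> (v u) + \<xi> (v w) :: bit)"
    using kempe_path[OF link] by blast
  define l where "l e = k e + arc u w e" for e
  have "bit_flow E t h l"
    unfolding bit_flow_def l_def using k(2) arc_boundary[of u w] uw
    by (simp add: distrib_right sum.distrib)
  moreover have "x e \<noteq> c" if "e \<in> E - K" "l e = 1" for e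
    using that k(1)[of e] arc_outside[of w e u] uw by (auto simp: l_def)
  ultimately have "(\<lambda>e. x e + (if l e = 1 then c else 0)) \<in> states"
    by (rule states_add[OF x])
  moreover have "l (d i) = of_bool (u \<le> i \<and> i < w)" if "i < m" for i
  proof -
    have "k (d i) = 0" using k(1)[of "d i"] d_in_K[OF that] by blast
    then show ?thesis using arc_d[OF that, of w u] uw by (simp add: l_def)
  qed
  ultimately show ?thesis by (intro bexI) auto
qed

lemma states_shift:
  assumes "x \<in> states"
  shows "(\<lambda>e. x e + (if e \<in> K then c else 0)) \<in> states"
proof -
  have "bit_flow E t h (arc 0 m)"
    using arc_boundary[of 0 m] v_m by (simp add: bit_flow_def)
  moreover have "d ` {0..<m} = K"
    using d_bij by (simp add: bij_betw_def atLeast0LessThan)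
  ultimately show ?thesis
    using states_add[OF assms, of "arc 0 m" c] by (simp add: arc_def)
qed

text \<open>\<open>\<phi>\<close> extends to a function on the vertices that is constant on the
  components of \<open>kempe x c\<close>. The Z_2-flow \<open>form c (x e)\<close> pairs to 0 with
  it, and an edge off the circuit where this flow is nonzero has both ends in one component, so the
  circuit's share of the sum is 0.\<close>

lemma kempe_handshake:
  assumes x: "x \<in> states" and \<phi>_m: "\<phi> m = \<phi> 0"
    and \<phi>: "\<And>u w. \<lbrakk>(v u, v w) \<in> (kempe x c)\<^sup>*; u \<le> w; w < m\<rbrakk> \<Longrightarrow> \<phi> u = \<phi> w"
  shows "(\<Sum>i<m. form c (x (d i)) * (\<phi> i + \<phi> (Suc i))) = (0 :: bit)"
proof -
  have sym_kempe: "(q, p) \<in> (kempe x c)\<^sup>*" if "(p, q) \<in> (kempe x c)\<^sup>*" for p q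
  proof -
    have "sym (kempe x c)" by (auto simp: sym_def kempe_def)
    then show ?thesis using that by (meson sym_rtrancl symD)
  qed
  have \<phi>': "\<phi> i = \<phi> j" if "(v i, p) \<in> (kempe x c)\<^sup>*" "(v j, p) \<in> (kempe x c)\<^sup>*" "i < m" "j < m" for i j p
  proof -
    have ij: "(v i, v j) \<in> (kempe x c)\<^sup>*" "(v j, v i) \<in> (kempe x c)\<^sup>*"
      using that sym_kempe by (meson rtrancl_trans)+
    show ?thesis
    proof (cases "i \<le> j")
      case True
      then show ?thesis using \<phi>[OF ij(1)] that by blast
    next
      case False
      then have "\<phi> j = \<phi> i" using \<phi>[OF ij(2)] that by simp
      then show ?thesis ..
    qed
  qed
  \<comment> \<open>Components that miss the circuit get the value 0; on the others every choice of
    \<open>i\<close> gives the same value by \<open>\<phi>'\<close>.\<close>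
  define \<xi> where "\<xi> p = (if \<exists>i<m. (v i, p) \<in> (kempe x c)\<^sup>* then \<phi> (SOME i. i < m \<and> (v i, p) \<in> (kempe x c)\<^sup>*) else 0)" for p
  have \<xi>: "\<xi> p = \<phi> i" if "i < m" "(v i, p) \<in> (kempe x c)\<^sup>*" for i p
  proof -
    let ?Q = "\<lambda>i. i < m \<and> (v i, p) \<in> (kempe x c)\<^sup>*"
    have "?Q (SOME i. ?Q i)" by (rule someI[of ?Q i]) (use that in blast)
    then have "\<phi> (SOME i. ?Q i) = \<phi> i" using \<phi>' that by blast
    then show ?thesis using that by (auto simp: \<xi>_def)
  qed
  have \<xi>_edge: "\<xi> p = \<xi> q" if "(p, q) \<in> kempe x c" for p q
  proof -
    have "(v i, p) \<in> (kempe x c)\<^sup>* \<longleftrightarrow> (v i, q) \<in> (kempe x c)\<^sup>*" for i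
      using that sym_kempe[of p q] by (meson r_into_rtrancl rtrancl_trans)
    then show ?thesis unfolding \<xi>_def by presburger
  qed
  have flow: "bit_flow E t h (\<lambda>e. form c (x e))"
    unfolding form_def using x by (intro bit_flow_add bit_flow_mult) (auto simp: states_def)
  have "0 = (\<Sum>e\<in>E - K. form c (x e) * (\<xi> (t e) + \<xi> (h e))) + (\<Sum>i<m. form c (x (d i)) * (\<xi> (v i) + \<xi> (v (Suc i))))"
    by (rule trans[OF bit_flowD[OF flow, symmetric] sum_E])
  also have "(\<Sum>e\<in>E - K. form c (x e) * (\<xi> (t e) + \<xi> (h e))) = 0"
  proof (rule sum.neutral, rule ballI)
    fix e assume e: "e \<in> E - K"
    show "form c (x e) * (\<xi> (t e) + \<xi> (h e)) = 0"
    proof (cases "form c (x e) = 1")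
      case True
      then have "(t e, h e) \<in> kempe x c" using e by (auto simp: kempe_def)
      then show ?thesis using \<xi>_edge by simp
    qed simp
  qed
  also have "(\<Sum>i<m. form c (x (d i)) * (\<xi> (v i) + \<xi> (v (Suc i)))) = (\<Sum>i<m. form c (x (d i)) * (\<phi> i + \<phi> (Suc i)))"
  proof (rule sum.cong)
    fix i assume i: "i \<in> {..<m}"
    have "\<xi> (v (Suc i)) = \<phi> (Suc i)"
      using i \<xi>[of "Suc i" "v (Suc i)"] \<xi>[of 0 "v 0"] v_m \<phi>_m by (cases "Suc i = m") auto
    then show "form c (x (d i)) * (\<xi> (v i) + \<xi> (v (Suc i))) = form c (x (d i)) * (\<phi> i + \<phi> (Suc i))"
      using \<xi>[of i "v i"] i by simp
  qed simp
  finally show ?thesis by simp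
qed

lemma ex_state_few_zeros:
  assumes "states \<noteq> {}"
  shows "\<exists>x\<in>states. 4 * card {i. i < m \<and> x (d i) = 0} < m"
proof (rule ccontr)
  assume "\<not> ?thesis"
  then have many: "m \<le> 4 * card {i. i < m \<and> x (d i) = 0}" if "x \<in> states" for x
    using that by (meson not_less)
  have "kempe_words m states (\<lambda>x i. x (d i)) (\<lambda>x c u w. (v u, v w) \<in> (kempe x c)\<^sup>*)"
  proof
    show "states \<noteq> {}" "m > 0" by (fact assms m_pos)+
    show "4 * card {i. i < m \<and> x (d i) = s} = m" if x: "x \<in> states" for x s
    proof -
      let ?n = "\<lambda>s. card {i. i < m \<and> x (d i) = s}"
      let ?S = "{0, 1 :: bit} \<times> {0, 1 :: bit}"
      \<comment> \<open>Adding \<open>s\<close> along the circuit turns the letter \<open>s\<close>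
        into 0, so the lower bound on zeros holds for every letter.\<close>
      have ge: "m \<le> 4 * ?n s" for s
      proof -
        have "x (d i) + s = 0 \<longleftrightarrow> x (d i) = s" for i
          by (auto simp: prod_eq_iff bit_add_eq_0_iff)
        then have "{i. i < m \<and> x (d i) + (if d i \<in> K then s else 0) = 0} = {i. i < m \<and> x (d i) = s}"
          using d_in_K by auto
        then show ?thesis using many[OF states_shift[OF x, of s]] by simp
      qed
      have in_S: "r \<in> ?S" for r
      proof -
        have *: "b \<in> {0, 1}" for b :: bit by (cases b) auto
        show ?thesis unfolding mem_Times_iff by (intro conjI *)
      qed
      have "(\<Sum>r\<in>?S. \<Sum>i\<in>{i \<in> {..<m}. x (d i) = r}. 1) = (\<Sum>i<m. 1 :: nat)"
        by (rule sum.group) (use in_S in auto)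
      then have "(\<Sum>r\<in>?S. ?n r) = m" by simp
      moreover have "(\<Sum>r\<in>?S - {s}. m) \<le> (\<Sum>r\<in>?S - {s}. 4 * ?n r)"
        by (intro sum_mono ge)
      then have "3 * m \<le> 4 * (\<Sum>r\<in>?S - {s}. ?n r)"
        using in_S[of s] by (simp add: card_cartesian_product sum_distrib_left)
      moreover have "(\<Sum>r\<in>?S. ?n r) = ?n s + (\<Sum>r\<in>?S - {s}. ?n r)"
        by (rule sum.remove) (use in_S in auto)
      ultimately show ?thesis using ge[of s] by linarith
    qed
  qed (use kempe_swap kempe_handshake in auto)
  then show False by (rule kempe_words.inconsistent)
qed

end

theorem corollary2p2:
  fixes G C :: "('v, 'e) multigraph"
  assumes "fin_multigraph G"
    and "subgraph_of C G"
    and "circuit C"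
    and "\<exists>D g. is_k_flow 4 (contract G (medges C)) D g
               \<and> nowhere_zero (contract G (medges C)) g"
  shows "\<exists>D f. is_k_flow 4 G D f
             \<and> medges G - medges C \<subseteq> flow_support G f
             \<and> real (card {e \<in> medges C. f e = 0}) < 1 / 4 * real (card (medges C))"
proof -
  interpret fin_multigraph G by fact
  let ?E = "medges G" and ?K = "medges C"
  let ?m = "card ?K"
  obtain t h where th: "\<And>e. mends G e = Upair (t e) (h e)"
    using ex_edge_ends[of G] by blast
  obtain v d where vd: "?m > 0" "bij_betw d {..<?m} ?K" "bij_betw v {..<?m} (mverts C)" "v ?m = v 0"
    "\<And>i. mends C (d i) = Upair (v i) (v (Suc i))"
    using circuit_enumeration[OF assms(3)] by blast
  interpret enumerated_circuit ?E ?K t h ?m v d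
  proof
    show "?K \<subseteq> ?E" using assms(2) by (simp add: subgraph_of_def)
    show "inj_on v {..<?m}" using vd(3) by (simp add: bij_betw_def)
    fix i assume "i < ?m"
    then have "d i \<in> ?K" using vd(2) by (auto simp: bij_betw_def)
    then have "Upair (t (d i)) (h (d i)) = Upair (v i) (v (Suc i))"
      using assms(2) vd(5)[of i] th[of "d i"] by (simp add: subgraph_of_def del: Upair_inject)
    then show "(t (d i) = v i \<and> h (d i) = v (Suc i)) \<or> (t (d i) = v (Suc i) \<and> h (d i) = v i)"
      by auto
  qed (use finite_medges vd in auto)
  obtain D g where Dg: "is_k_flow 4 (contract G ?K) D g" "nowhere_zero (contract G ?K) g"
    using assms(4) by blast
  have edges: "medges (contract G ?K) = ?E - ?K" by (simp add: contract_def)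
  have D: "orientation_of D (contract G ?K)"
    using Dg(1) by (simp add: is_k_flow_def is_flow_def)
  then have "int_flow (?E - ?K) (tail D) (head D) g"
    using is_flow_iff_int_flow[OF fin_multigraph_contract[OF assms(1)] D] Dg(1) edges by (simp add: is_k_flow_def)
  moreover have "g e \<noteq> 0 \<and> \<bar>g e\<bar> < 4" if "e \<in> ?E - ?K" for e
    using that Dg edges by (auto simp: is_k_flow_def nowhere_zero_def flow_support_def)
  ultimately obtain y z where yz: "bit_flow (?E - ?K) (tail D) (head D) y" "bit_flow (?E - ?K) (tail D) (head D) z"
    "\<And>e. e \<in> ?E - ?K \<Longrightarrow> y e \<noteq> 0 \<or> z e \<noteq> 0"
    using bit_flow_pair_of_int_flow[of "?E - ?K" "tail D" "head D" g] finite_medges by auto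
  have extend: "\<exists>b'. bit_flow ?E t h b' \<and> (\<forall>e\<in>?E - ?K. b' e = b e)"
    if b: "bit_flow (?E - ?K) (tail D) (head D) b" for b
  proof -
    have "(\<Sum>e\<in>?E - ?K. b e * (\<xi> (t e) + \<xi> (h e))) = 0"
      if \<xi>: "\<And>i. i < ?m \<Longrightarrow> \<xi> (v i) = \<xi> (v 0)" for \<xi> :: "'v \<Rightarrow> bit"
    proof (rule bit_flow_contract[OF K_subset th D b assms(1)])
      fix e assume "e \<in> ?K"
      then obtain i where i: "i < ?m" "e = d i" using vd(2) by (auto simp: bij_betw_def)
      have "\<xi> (v j) = \<xi> (v 0)" if "j \<le> ?m" for j
        using \<xi>[of j] v_m that by (cases "j = ?m") auto
      from this[of i] this[of "Suc i"] show "\<xi> (t e) = \<xi> (h e)"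
        using d_ends[OF i(1)] i by auto
    qed
    then obtain z where "bit_flow ?E t h z" "\<And>e. e \<in> ?E - ?K \<Longrightarrow> z e = b e"
      by (rule bit_flow_extend[of b]) blast+
    then show ?thesis by blast
  qed
  obtain y' where y': "bit_flow ?E t h y'" "\<And>e. e \<in> ?E - ?K \<Longrightarrow> y' e = y e" using extend[OF yz(1)] by blast
  obtain z' where z': "bit_flow ?E t h z'" "\<And>e. e \<in> ?E - ?K \<Longrightarrow> z' e = z e" using extend[OF yz(2)] by blast
  have "(\<lambda>e. (y' e, z' e)) \<in> states"
    using y' z' yz(3) by (auto simp: states_def zero_prod_def)
  then obtain x where x: "x \<in> states" "4 * card {i. i < ?m \<and> x (d i) = 0} < ?m"
    using ex_state_few_zeros by blast
  obtain f where f: "int_flow ?E t h f" "\<And>e. e \<in> ?E \<Longrightarrow> \<bar>f e\<bar> < 4"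
    "\<And>e. e \<in> ?E \<Longrightarrow> f e = 0 \<longleftrightarrow> fst (x e) = 0 \<and> snd (x e) = 0"
    using int_flow_of_bit_flow_pair[OF finite_medges, of t h "\<lambda>e. fst (x e)" "\<lambda>e. snd (x e)"] x(1)
    by (auto simp: states_def)
  have f0: "f e = 0 \<longleftrightarrow> x e = 0" if "e \<in> ?E" for e
    using f(3)[OF that] by (simp add: prod_eq_iff)
  let ?D = "\<lparr>verts = mverts G, arcs = ?E, tail = t, head = h\<rparr>"
  have "orientation_of ?D G" using th by (simp add: orientation_of_def)
  then have "is_k_flow 4 G ?D f"
    using is_flow_iff_int_flow[OF assms(1), of ?D f] f by (simp add: is_k_flow_def)
  moreover have "?E - ?K \<subseteq> flow_support G f"
    using x(1) f0 by (auto simp: states_def flow_support_def)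
  moreover have "bij_betw d {i. i < ?m \<and> x (d i) = 0} {e \<in> ?K. f e = 0}"
  proof -
    have "{e \<in> ?K. f e = 0} = {e \<in> ?K. x e = 0}" using f0 K_subset by blast
    moreover have "d ` {i. i < ?m \<and> x (d i) = 0} = {e \<in> ?K. x e = 0}"
      using vd(2) by (auto simp: bij_betw_def)
    moreover have "inj_on d {i. i < ?m \<and> x (d i) = 0}"
      using vd(2) by (auto simp: bij_betw_def inj_on_def)
    ultimately show ?thesis by (simp add: bij_betw_def)
  qed
  then have "card {e \<in> ?K. f e = 0} = card {i. i < ?m \<and> x (d i) = 0}"
    by (rule bij_betw_same_card[symmetric])
  then have "real (card {e \<in> ?K. f e = 0}) < 1 / 4 * real ?m"
    using x(2) by linarith
  ultimately show ?thesis by blast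
qed

end
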